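(* Let $p(g\mid\mathbf w)=\sum_{k\in\mathcal A}\theta_kP_{(k)}(w_{-k},g)$ be an imitation kernel on a finite set $G$. Then $|\mathcal G(p)|=1$ if and only if the $G$-stochastic function $P_{(\cdot)}$ is essentially irreducible and its unique closed intercommunicating class $R$ is aperiodic, i.e. $\gcd\{s(\mathbf a):\mathbf a\in\mathcal A^*, P_{\mathbf a}(i,i)>0\}=\gcd(\mathcal A)$ for $i\in R$.
   Context: $\mathcal A\subset\mathbb N_+$, $\theta$ a probability on $\mathcal A$ with $\theta_k>0$ for $k\in\mathcal A$, $P_{(k)}$ stochastic matrices on $G$, $\mathbf w=(w_{-1},w_{-2},\dots)$. A law of $(X_n)_{n\in\mathbb Z}$ on $G^{\mathbb Z}$ is compatible with $p$ if $P(X_n=g\mid X_{n-1},X_{n-2},\dots)=p(g\mid X_{n-1},X_{n-2},\dots)$ a.s. for all $n,g$; $\mathcal G(p)$ is the set of compatible laws. Words $\mathcal A^*=\bigcup_{n\ge1}\mathcal A^n$, $P_{\mathbf a}=P_{(a_n)}\cdots P_{(a_1)}$, depth $s(\mathbf a)=\sum a_i$. $i$ communicates with $j\neq i$ if $P_{\mathbf a}(i,j)>0$ for some word; intercommunication (with each state intercommunicating with itself) partitions $G$ into classes; a class $C$ is closed if $i\in C$ communicating with $j$ implies $j\in C$. $P_{(\cdot)}$ is essentially irreducible if it has exactly one closed intercommunicating class. (When $\gcd(\mathcal A)=1$, aperiodicity of $R$ means all states of $R$ have period $1$.) *)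

theory Defs
  imports "HOL-Probability.Probability"
begin

text \<open>Pasts: a past configuration w = (w_{-1}, w_{-2}, ...) is a function
  w :: nat => 'g with w k = w_{-k} for k >= 1 (the value w 0 is a dummy and
  is never used by imitation kernels, since A is a subset of the positive integers).\<close>

definition imitation_kernel ::
  "nat set \<Rightarrow> (nat \<Rightarrow> real) \<Rightarrow> (nat \<Rightarrow> 'g \<Rightarrow> 'g \<Rightarrow> real) \<Rightarrow> 'g \<Rightarrow> (nat \<Rightarrow> 'g) \<Rightarrow> real" where
  "imitation_kernel A \<theta> P g w = (\<Sum>\<^sub>\<infinity>k\<in>A. \<theta> k * P k (w k) g)"

definition pathspace :: "(int \<Rightarrow> 'g) measure" where
  "pathspace = PiM UNIV (\<lambda>_. count_space UNIV)"

definition past_alg :: "(int \<Rightarrow> 'g) measure \<Rightarrow> int \<Rightarrow> (int \<Rightarrow> 'g) measure" where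
  "past_alg M n = sigma (space M) {{x \<in> space M. x m \<in> B} | m B. m < n}"

definition compatible :: "('g \<Rightarrow> (nat \<Rightarrow> 'g) \<Rightarrow> real) \<Rightarrow> (int \<Rightarrow> 'g) measure \<Rightarrow> bool" where
  "compatible p M \<longleftrightarrow> prob_space M \<and> sets M = sets pathspace \<and>
     (\<forall>n g. AE x in M. real_cond_exp M (past_alg M n) (\<lambda>y. indicator {y. y n = g} y) x
                         = p g (\<lambda>k. x (n - int k)))"

definition compatible_laws :: "('g \<Rightarrow> (nat \<Rightarrow> 'g) \<Rightarrow> real) \<Rightarrow> (int \<Rightarrow> 'g) measure set" where
  "compatible_laws p = {M. compatible p M}"

definition mmul :: "('g::finite \<Rightarrow> 'g \<Rightarrow> real) \<Rightarrow> ('g \<Rightarrow> 'g \<Rightarrow> real) \<Rightarrow> 'g \<Rightarrow> 'g \<Rightarrow> real" where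
  "mmul X Y i j = (\<Sum>l\<in>UNIV. X i l * Y l j)"

fun word_mat :: "(nat \<Rightarrow> 'g::finite \<Rightarrow> 'g \<Rightarrow> real) \<Rightarrow> nat list \<Rightarrow> 'g \<Rightarrow> 'g \<Rightarrow> real" where
  "word_mat P [] = (\<lambda>i j. if i = j then 1 else 0)"
| "word_mat P (a # as) = mmul (word_mat P as) (P a)"

definition words :: "nat set \<Rightarrow> nat list set" where
  "words A = {a. a \<noteq> [] \<and> set a \<subseteq> A}"

definition depth :: "nat list \<Rightarrow> nat" where
  "depth a = sum_list a"

definition communicates :: "nat set \<Rightarrow> (nat \<Rightarrow> 'g::finite \<Rightarrow> 'g \<Rightarrow> real) \<Rightarrow> 'g \<Rightarrow> 'g \<Rightarrow> bool" where
  "communicates A P i j \<longleftrightarrow> (\<exists>a\<in>words A. word_mat P a i j > 0)"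

definition intercomm :: "nat set \<Rightarrow> (nat \<Rightarrow> 'g::finite \<Rightarrow> 'g \<Rightarrow> real) \<Rightarrow> 'g \<Rightarrow> 'g \<Rightarrow> bool" where
  "intercomm A P i j \<longleftrightarrow> i = j \<or> (communicates A P i j \<and> communicates A P j i)"

definition classes :: "nat set \<Rightarrow> (nat \<Rightarrow> 'g::finite \<Rightarrow> 'g \<Rightarrow> real) \<Rightarrow> 'g set set" where
  "classes A P = UNIV // {(i, j). intercomm A P i j}"

definition closed_class :: "nat set \<Rightarrow> (nat \<Rightarrow> 'g::finite \<Rightarrow> 'g \<Rightarrow> real) \<Rightarrow> 'g set \<Rightarrow> bool" where
  "closed_class A P C \<longleftrightarrow> (\<forall>i\<in>C. \<forall>j. communicates A P i j \<longrightarrow> j \<in> C)"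

definition essentially_irreducible :: "nat set \<Rightarrow> (nat \<Rightarrow> 'g::finite \<Rightarrow> 'g \<Rightarrow> real) \<Rightarrow> bool" where
  "essentially_irreducible A P \<longleftrightarrow> (\<exists>!C. C \<in> classes A P \<and> closed_class A P C)"

definition aperiodic_class :: "nat set \<Rightarrow> (nat \<Rightarrow> 'g::finite \<Rightarrow> 'g \<Rightarrow> real) \<Rightarrow> 'g set \<Rightarrow> bool" where
  "aperiodic_class A P R \<longleftrightarrow>
     (\<forall>i\<in>R. Gcd {depth a | a. a \<in> words A \<and> word_mat P a i i > 0} = Gcd A)"

definition stochastic :: "('g::finite \<Rightarrow> 'g \<Rightarrow> real) \<Rightarrow> bool" where
  "stochastic Q \<longleftrightarrow> (\<forall>i j. Q i j \<ge> 0) \<and> (\<forall>i. (\<Sum>j\<in>UNIV. Q i j) = 1)"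

end

theory Submission
  imports Defs "HOL-Complex_Analysis.Great_Picard"
begin

text \<open>
  Uniqueness: let \<open>D\<close> be the difference of the expectations of a product \<open>\<Prod> f\<^sub>i(X\<^bsub>n_i\<^esub>)\<close> under two
  compatible laws. Conditioning the topmost site \<open>n\<close> on its past replaces \<open>(n, f)\<close> by
  \<open>(n - k, P\<^sub>k f)\<close> with probability \<open>\<theta>\<^sub>k\<close>, so the factors move down along ancestral lines until two of
  them meet and merge. By induction on the number of factors, \<open>D\<close> vanishes after a merger and does
  not change if a constant is added to one \<open>f\<^sub>i\<close>. Irreducibility and aperiodicity give a depth \<open>L\<close> at
  which the words of depth \<open>L\<close> lead from every state to one common state; hence moving one factor
  down by exactly \<open>L\<close> contracts it modulo constants. All gap configurations are treated by the same
  bounded number of moves, so \<open>sup |D| \<le> (1 - \<delta>) sup |D|\<close>.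

  Existence: a subsequential limit of the processes started from frozen configurations at \<open>-N\<close>.
  The supports of the starting configurations survive in the limit, so two closed classes, or two
  phases of a periodic class, produce two different laws.
\<close>

section \<open>Words, communication and periods\<close>

text \<open>Ancestral lines need not ever meet: sites in different residue classes modulo
  \<open>Gcd A\<close> never do. So the proof does not wait for mergers; it contracts one factor
  while the others stay apart. The obstacle is that a site can be conditioned on its past only while
  it is strictly the highest one, so a factor cannot be lowered by \<open>L\<close> unless the
  others get out of its way, and the gaps between the sites are unbounded. Therefore the highest
  factor, at \<open>n\<close>, is contracted down to \<open>c = n - L\<close>, and every other
  factor above \<open>c\<close> is pushed to \<open>c\<close> or below by repeating one letter
  \<open>a\<close>. Since no site lies above \<open>n\<close>, at most \<open>L + r * L\<close>
  moves are followed when there are \<open>r\<close> other factors, and each has probability at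
  least \<open>\<kappa>\<close>, the least weight among the finitely many letters up to
  \<open>K\<close>. All remaining choices of letters are estimated by the supremum \<open>S\<close>.
  Hence the shape of the bookkeeping, which averaging over letters preserves: value minus weight
  times main term is at most (1 - weight) times \<open>S\<close>.\<close>

lemma additive_difference_generates:
  fixes S :: "nat set"
  assumes add: "\<And>a b. a \<in> S \<Longrightarrow> b \<in> S \<Longrightarrow> a + b \<in> S" and pos: "Gcd S > 0"
  shows "\<exists>b\<in>S. b + Gcd S \<in> S"
proof -
  \<comment> \<open>\<open>e\<close> is the least positive difference of two elements. Dividing
    \<open>x\<close> in \<open>S\<close> by \<open>e\<close> exhibits \<open>x mod e\<close> as a
    difference too, so it is 0 and \<open>e\<close> divides all of \<open>S\<close>.\<close>
  define e where "e = (LEAST e. e > 0 \<and> (\<exists>a\<in>S. a + e \<in> S))"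
  obtain s where s: "s \<in> S" "s > 0"
    using pos by (metis Gcd_0_iff bot_nat_0.not_eq_extremum insert_iff subsetI)
  then have ex: "\<exists>e. e > 0 \<and> (\<exists>a\<in>S. a + e \<in> S)" using add by blast
  have e: "e > 0" "\<exists>a\<in>S. a + e \<in> S"
    using LeastI_ex[OF ex] unfolding e_def by auto
  have e_le: "e \<le> y" if "y > 0" "\<exists>a\<in>S. a + y \<in> S" for y
    unfolding e_def using that by (intro Least_le conjI)
  obtain b where b: "b \<in> S" "b + e \<in> S" using e(2) by blast
  have mult: "(m * x) + y \<in> S" if "x \<in> S" "y \<in> S" for m x y
    using that by (induction m) (auto simp: add.assoc intro: add)
  have "e dvd x" if x: "x \<in> S" for x
  proof (rule ccontr)
    assume "\<not> e dvd x"
    then have r: "x mod e > 0" by (simp add: mod_greater_zero_iff_not_dvd)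
    \<comment> \<open>Both elements carry an extra summand \<open>b\<close>, because
      \<open>S\<close> need not contain 0 and the quotient may be 0.\<close>
    have 1: "(x div e) * (b + e) + b \<in> S" using mult[OF b(2,1)] .
    have 2: "(x div e) * b + (b + x) \<in> S" using mult[OF b(1) add[OF b(1) x]] .
    have "(x div e) * b + (b + (x div e * e + x mod e)) = ((x div e) * (b + e) + b) + x mod e"
      by (simp only: add_mult_distrib add_mult_distrib2 ac_simps)
    then have "(x div e) * b + (b + x) = ((x div e) * (b + e) + b) + x mod e" by simp
    then have "\<exists>a\<in>S. a + x mod e \<in> S" using 1 2 by metis
    then have "e \<le> x mod e" using e_le r by blast
    then show False using e(1) by (meson mod_less_divisor not_less)
  qed
  then have "e dvd Gcd S" by (simp add: Gcd_greatest)
  moreover have "Gcd S dvd e"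
    using b Gcd_dvd dvd_add_right_iff by metis
  ultimately have "e = Gcd S" by (simp add: dvd_antisym)
  with b show ?thesis by blast
qed

text \<open>With \<open>b = d * m\<close> and \<open>b + d\<close> in \<open>S\<close>, write
  \<open>n = d * q\<close> and \<open>q = m * u + v\<close> with \<open>v < m\<close>; then
  \<open>n = (u - v) * b + v * (b + d)\<close>.\<close>

lemma additive_contains_large_multiples:
  fixes S :: "nat set"
  assumes add: "\<And>a b. a \<in> S \<Longrightarrow> b \<in> S \<Longrightarrow> a + b \<in> S" and pos: "Gcd S > 0"
  shows "\<exists>N. \<forall>n\<ge>N. Gcd S dvd n \<longrightarrow> n \<in> S"
proof -
  define d where "d = Gcd S"
  obtain b where b: "b \<in> S" "b + d \<in> S"
    using additive_difference_generates[OF assms] d_def by blast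
  obtain m where m: "b = d * m" using b(1) unfolding d_def by (meson Gcd_dvd dvdE)
  have mult: "m * x \<in> S" if "x \<in> S" "m > 0" for m x
    using that(2,1) by (induction m rule: nat_induct_non_zero) (auto intro: add)
  \<comment> \<open>\<open>q \<ge> m * m\<close> forces \<open>u \<ge> m > v\<close>, so the
    coefficient of \<open>b\<close> is positive; the \<open>+ 1\<close> keeps \<open>q\<close>
    positive when \<open>m = 0\<close>.\<close>
  have "n \<in> S" if n: "n \<ge> d * (m * m + 1)" "d dvd n" for n
  proof -
    obtain q where q: "n = d * q" using n(2) by blast
    have "q \<ge> m * m + 1" using n(1) pos unfolding q d_def by (simp only: mult_le_cancel1)
    show ?thesis
    proof (cases "m = 0")
      case True
      then have "d \<in> S" using b(2) m by simp
      moreover have "q > 0" using \<open>q \<ge> m * m + 1\<close> by linarith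
      ultimately have "q * d \<in> S" by (rule mult)
      then show ?thesis using q by (simp add: mult.commute)
    next
      case False
      define u v where "u = q div m" and "v = q mod m"
      have uv: "q = m * u + v" "v < m" using False by (auto simp: u_def v_def)
      have "u \<ge> m"
        using \<open>q \<ge> m * m + 1\<close> unfolding u_def
        using div_le_mono[of "m * m" q m] False by simp
      then have uvp: "u - v > 0" using uv by simp
      have "n = (u - v) * b + v * (b + d)"
      proof -
        have "(u - v) * b + v * (b + d) = ((u - v) + v) * b + v * d"
          by (simp only: add_mult_distrib add_mult_distrib2 add.assoc)
        also have "\<dots> = u * b + v * d" using uvp by simp
        also have "\<dots> = n" unfolding q uv(1) m by (simp add: algebra_simps)
        finally show ?thesis by simp
      qed
      moreover have "(u - v) * b \<in> S" using uvp b mult by blast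
      ultimately show ?thesis
        using add mult[OF b(2), of v] by (cases "v = 0") auto
    qed
  qed
  then show ?thesis unfolding d_def by blast
qed

section \<open>Words as paths, reachability and closed classes\<close>

locale imitation =
  fixes A :: "nat set" and \<theta> :: "nat \<Rightarrow> real" and P :: "nat \<Rightarrow> 'g::finite \<Rightarrow> 'g \<Rightarrow> real"
  assumes A_pos: "A \<subseteq> {1..}"
    and theta_pos: "\<And>k. k \<in> A \<Longrightarrow> \<theta> k > 0"
    and theta_prob: "(\<theta> has_sum 1) A"
    and P_stoch: "\<And>k. k \<in> A \<Longrightarrow> stochastic (P k)"
begin

lemma P_nonneg: "k \<in> A \<Longrightarrow> P k i j \<ge> 0"
  and P_sum: "k \<in> A \<Longrightarrow> (\<Sum>j\<in>UNIV. P k i j) = 1"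
  using P_stoch by (auto simp: stochastic_def)

lemma P_ex_pos:
  assumes "k \<in> A"
  shows "\<exists>j. P k i j > 0"
proof (rule ccontr)
  assume "\<not> ?thesis"
  then have "P k i j \<le> 0" for j by (simp add: not_less)
  then have "(\<Sum>j\<in>UNIV. P k i j) \<le> 0" by (simp add: sum_nonpos)
  then show False using P_sum[OF assms, of i] by simp
qed

lemma zero_notin_A: "0 \<notin> A"
  using A_pos by auto

lemma A_nonempty: "A \<noteq> {}"
proof
  assume "A = {}"
  then have "(1::real) = 0" using theta_prob has_sum_empty by (metis has_sum_unique)
  then show False by simp
qed

lemma Gcd_A_pos: "Gcd A > 0"
proof -
  obtain k where "k \<in> A" "k \<noteq> 0" using A_nonempty zero_notin_A by (metis ex_in_conv)
  then have "Gcd A \<noteq> 0" by (metis Gcd_dvd dvd_0_left_iff)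
  then show ?thesis using neq0_conv by blast
qed

lemma word_mat_nonneg: "set a \<subseteq> A \<Longrightarrow> word_mat P a i j \<ge> 0"
  by (induction a arbitrary: i j) (auto simp: mmul_def intro!: sum_nonneg mult_nonneg_nonneg P_nonneg)

lemma word_mat_Cons_pos:
  assumes "k \<in> A" "set a \<subseteq> A"
  shows "word_mat P (k # a) i j > 0 \<longleftrightarrow> (\<exists>l. word_mat P a i l > 0 \<and> P k l j > 0)"
proof -
  have nn: "word_mat P a i l * P k l j \<ge> 0" for l
    using assms by (simp add: P_nonneg word_mat_nonneg)
  have "word_mat P (k # a) i j > 0 \<longleftrightarrow> (\<exists>l. word_mat P a i l * P k l j > 0)"
  proof
    assume "word_mat P (k # a) i j > 0"
    then have "\<not> (\<Sum>l\<in>UNIV. word_mat P a i l * P k l j) \<le> 0" by (simp add: mmul_def)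
    then show "\<exists>l. word_mat P a i l * P k l j > 0" by (meson not_le sum_nonpos)
  next
    assume "\<exists>l. word_mat P a i l * P k l j > 0"
    then obtain l where "word_mat P a i l * P k l j > 0" ..
    then have "(\<Sum>l\<in>UNIV. word_mat P a i l * P k l j) > 0"
      using nn by (intro sum_pos2[of _ l]) auto
    then show "word_mat P (k # a) i j > 0" by (simp add: mmul_def)
  qed
  moreover have "word_mat P a i l * P k l j > 0 \<longleftrightarrow> word_mat P a i l > 0 \<and> P k l j > 0" for l
    using word_mat_nonneg[OF assms(2), of i l] P_nonneg[OF assms(1), of l j]
    by (simp add: zero_less_mult_iff)
  ultimately show ?thesis by simp
qed

text \<open>The head of a list is the last step of the path, so the path along \<open>a\<close>
  continued along \<open>b\<close> has the word \<open>b @ a\<close>.\<close>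

lemma word_mat_append_pos:
  assumes "set a \<subseteq> A" "set b \<subseteq> A" "word_mat P a i l > 0" "word_mat P b l j > 0"
  shows "word_mat P (b @ a) i j > 0"
  using assms(2,4)
proof (induction b arbitrary: j)
  case Nil
  then show ?case using assms by (auto split: if_splits)
next
  case (Cons k b)
  then obtain m where "word_mat P b l m > 0" "P k m j > 0"
    using word_mat_Cons_pos[of k b] by auto
  then show ?case
    using Cons word_mat_Cons_pos[of k "b @ a"] assms(1) by auto
qed

lemma word_mat_ex_pos: "set a \<subseteq> A \<Longrightarrow> \<exists>j. word_mat P a i j > 0"
proof (induction a)
  case Nil
  show ?case by (rule exI[of _ i]) simp
next
  case (Cons k a)
  then obtain l where "word_mat P a i l > 0" by auto
  moreover obtain j where "P k l j > 0" using P_ex_pos[of k l] Cons by auto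
  ultimately have "word_mat P (k # a) i j > 0"
    using word_mat_Cons_pos[of k a i j] Cons.prems by (metis insert_subset list.simps(15))
  then show ?case ..
qed

definition reach :: "'g \<Rightarrow> 'g \<Rightarrow> bool" where
  "reach i j \<longleftrightarrow> (\<exists>a. set a \<subseteq> A \<and> word_mat P a i j > 0)"

lemma reach_refl: "reach i i"
  unfolding reach_def by (rule exI[of _ "[]"]) simp

lemma reach_iff: "reach i j \<longleftrightarrow> i = j \<or> communicates A P i j"
proof
  assume "reach i j"
  then obtain a where a: "set a \<subseteq> A" "word_mat P a i j > 0" unfolding reach_def by blast
  show "i = j \<or> communicates A P i j"
  proof (cases "a = []")
    case True
    then show ?thesis using a(2) by (simp split: if_splits)
  next
    case False
    then show ?thesis using a unfolding communicates_def words_def by blast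
  qed
next
  assume "i = j \<or> communicates A P i j"
  then show "reach i j"
    using reach_refl by (auto simp: reach_def communicates_def words_def)
qed

lemma reach_trans:
  assumes "reach i j" "reach j k"
  shows "reach i k"
proof -
  obtain a b where "set a \<subseteq> A" "word_mat P a i j > 0" "set b \<subseteq> A" "word_mat P b j k > 0"
    using assms unfolding reach_def by blast
  then have "set (b @ a) \<subseteq> A" "word_mat P (b @ a) i k > 0"
    using word_mat_append_pos[of a b i j k] by simp_all
  then show ?thesis unfolding reach_def by blast
qed

lemma classes_iff: "C \<in> classes A P \<longleftrightarrow> (\<exists>i. C = {j. reach i j \<and> reach j i})"
proof -
  have "{(i, j). intercomm A P i j} `` {i} = {j. reach i j \<and> reach j i}" for i
    by (auto simp: intercomm_def reach_iff)
  then show ?thesis unfolding classes_def quotient_def by simp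
qed

lemma class_reach:
  assumes "C \<in> classes A P" "i \<in> C" "j \<in> C"
  shows "reach i j"
proof -
  obtain c where "C = {j. reach c j \<and> reach j c}" using assms(1) classes_iff by metis
  then have "reach i c" "reach c j" using assms by auto
  then show ?thesis by (rule reach_trans)
qed

lemma closed_class_iff: "closed_class A P C \<longleftrightarrow> (\<forall>i\<in>C. \<forall>j. reach i j \<longrightarrow> j \<in> C)"
  by (auto simp: closed_class_def reach_iff)

text \<open>Among the states reachable from \<open>i\<close>, take \<open>j\<close> with the fewest
  reachable states. Anything reachable from \<open>j\<close> then reaches exactly as much as
  \<open>j\<close>, in particular \<open>j\<close> itself, so the class of \<open>j\<close> is
  closed.\<close>

lemma closed_class_reachable:
  "\<exists>C\<in>classes A P. closed_class A P C \<and> (\<forall>j\<in>C. reach i j)"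
proof -
  define R where "R j = {k. reach j k}" for j
  obtain j where j: "reach i j" and least: "\<And>k. reach i k \<Longrightarrow> card (R j) \<le> card (R k)"
    using ex_has_least_nat[of "reach i" i "\<lambda>j. card (R j)"] reach_refl by blast
  have rev_reach: "reach k j" if "reach j k" for k
  proof -
    have "R k \<subseteq> R j" using that reach_trans unfolding R_def by blast
    moreover have "card (R j) \<le> card (R k)" using least j that reach_trans by blast
    ultimately have "R k = R j" by (simp add: card_seteq)
    then show ?thesis using reach_refl unfolding R_def by blast
  qed
  have "{k. reach j k \<and> reach k j} \<in> classes A P" using classes_iff by blast
  moreover have "closed_class A P {k. reach j k \<and> reach k j}"
    using closed_class_iff rev_reach reach_trans by blast
  ultimately show ?thesis using j reach_trans by blast
qed

lemma reach_unique_closed_class: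
  assumes "essentially_irreducible A P" "R \<in> classes A P" "closed_class A P R" "j \<in> R"
  shows "reach i j"
proof -
  obtain C where C: "C \<in> classes A P" "closed_class A P C" "\<forall>j\<in>C. reach i j"
    using closed_class_reachable[of i] by blast
  then have "C = R"
    using assms(1-3) unfolding essentially_irreducible_def by metis
  then show ?thesis using C assms(4) by blast
qed

section \<open>Return depths and periods\<close>

lemma sum_list_dvd: "set a \<subseteq> A \<Longrightarrow> Gcd A dvd depth a"
  unfolding depth_def by (induction a) (simp_all add: Gcd_dvd dvd_add)

definition return_depths :: "'g \<Rightarrow> nat set" where
  "return_depths i = {depth a | a. a \<in> words A \<and> word_mat P a i i > 0}"

lemma return_depths_add: "s \<in> return_depths i \<Longrightarrow> t \<in> return_depths i \<Longrightarrow> s + t \<in> return_depths i"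
  unfolding return_depths_def words_def
proof safe
  fix a b assume "set a \<subseteq> A" "0 < word_mat P a i i" "a \<noteq> []" "set b \<subseteq> A" "0 < word_mat P b i i"
  then show "\<exists>c. depth a + depth b = depth c \<and> c \<in> {a. a \<noteq> [] \<and> set a \<subseteq> A} \<and> word_mat P c i i > 0"
    using word_mat_append_pos[of a b i i i] by (intro exI[of _ "b @ a"]) (simp add: depth_def)
qed

lemma depth_word_pos:
  assumes "a \<in> words A"
  shows "depth a > 0"
proof -
  obtain k b where "a = k # b" "k \<in> A" using assms unfolding words_def by (cases a) auto
  moreover have "k \<noteq> 0" using zero_notin_A \<open>k \<in> A\<close> by metis
  ultimately show ?thesis by (simp add: depth_def)
qed

text \<open>A step out of \<open>i\<close> stays in the closed class, and every state of the class
  leads back to \<open>i\<close>.\<close>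

lemma return_depths_nonempty:
  assumes "R \<in> classes A P" "closed_class A P R" "i \<in> R"
  shows "return_depths i \<noteq> {}"
proof -
  obtain k where k: "k \<in> A" using A_nonempty by blast
  obtain j where j: "word_mat P [k] i j > 0"
    using word_mat_ex_pos[of "[k]" i] k by auto
  then have "reach i j" unfolding reach_def using k by (intro exI[of _ "[k]"]) auto
  then have "j \<in> R" using assms closed_class_iff by blast
  then have "reach j i" using assms class_reach by blast
  then obtain b where "set b \<subseteq> A" "word_mat P b j i > 0" unfolding reach_def by blast
  with j k have "word_mat P (b @ [k]) i i > 0" using word_mat_append_pos[of "[k]" b i j i] by simp
  then show ?thesis unfolding return_depths_def words_def
    using k \<open>set b \<subseteq> A\<close> by (auto intro!: exI[of _ "b @ [k]"])
qed

lemma Gcd_return_depths_pos: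
  assumes "R \<in> classes A P" "closed_class A P R" "i \<in> R"
  shows "Gcd (return_depths i) > 0"
proof -
  obtain s where "s \<in> return_depths i" using return_depths_nonempty[OF assms] by blast
  moreover from this have "s > 0" using depth_word_pos unfolding return_depths_def by blast
  ultimately have "Gcd (return_depths i) \<noteq> 0" by (metis Gcd_dvd dvd_0_left_iff less_irrefl)
  then show ?thesis using neq0_conv by blast
qed

text \<open>A word from \<open>i\<close> to \<open>j\<close> is padded by a loop at
  \<open>j\<close>. The missing depth is a multiple of \<open>Gcd A\<close>, which is the period of
  \<open>j\<close>, so all large values of it are return depths.\<close>

lemma uniform_depth:
  assumes R: "R \<in> classes A P" "closed_class A P R" "j \<in> R"
    and ess: "essentially_irreducible A P" and ap: "Gcd (return_depths j) = Gcd A"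
  shows "\<exists>L. \<forall>i. \<exists>a. set a \<subseteq> A \<and> depth a = L \<and> word_mat P a i j > 0"
proof -
  obtain N where N: "\<And>n. n \<ge> N \<Longrightarrow> Gcd A dvd n \<Longrightarrow> n \<in> return_depths j"
    using additive_contains_large_multiples[OF return_depths_add Gcd_return_depths_pos[OF R]] unfolding ap by blast
  have "\<exists>a. set a \<subseteq> A \<and> word_mat P a i j > 0" for i
    using reach_unique_closed_class[OF ess R, of i] unfolding reach_def .
  then obtain w where w: "\<And>i. set (w i) \<subseteq> A" "\<And>i. word_mat P (w i) i j > 0" by metis
  \<comment> \<open>A multiple of \<open>Gcd A\<close>, as all word depths are, and large enough
    that every deficit \<open>L - depth (w i)\<close> is at least \<open>N\<close>.\<close>
  define L where "L = Gcd A * (N + 1 + (\<Sum>i\<in>UNIV. depth (w i)))"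
  have g: "Gcd A \<ge> 1" using Gcd_A_pos by simp
  have L_ge: "L \<ge> N + 1 + (\<Sum>i\<in>UNIV. depth (w i))"
    unfolding L_def using mult_le_mono1[OF g] by (metis nat_mult_1)
  have "\<exists>a. set a \<subseteq> A \<and> depth a = L \<and> word_mat P a i j > 0" for i
  proof -
    have "depth (w i) \<le> (\<Sum>i\<in>UNIV. depth (w i))" by (rule member_le_sum) auto
    then have le: "depth (w i) + N \<le> L" using L_ge by linarith
    have "Gcd A dvd L - depth (w i)"
      using sum_list_dvd[OF w(1)] by (simp add: L_def dvd_diff_nat)
    then have "L - depth (w i) \<in> return_depths j" using N le by simp
    then obtain b where b: "b \<in> words A" "word_mat P b j j > 0" "depth b = L - depth (w i)"
      unfolding return_depths_def by auto
    then show ?thesis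
      using w le word_mat_append_pos[of "w i" b i j j]
      by (intro exI[of _ "b @ w i"]) (auto simp: words_def depth_def)
  qed
  then show ?thesis by blast
qed

section \<open>Families of supports preserved by imitation\<close>

text \<open>The sets depend on the site so that one notion covers closed classes (constant families)
  and the phases of a periodic class.\<close>

definition invariant_sets :: "(int \<Rightarrow> 'g set) \<Rightarrow> bool" where
  "invariant_sets V \<longleftrightarrow>
    (\<forall>n. V n \<noteq> {}) \<and> (\<forall>n. \<forall>k\<in>A. \<forall>i j. i \<in> V (n - int k) \<longrightarrow> P k i j > 0 \<longrightarrow> j \<in> V n)"

lemma reach_step: "k \<in> A \<Longrightarrow> P k i j > 0 \<Longrightarrow> reach i j"
  unfolding reach_def using word_mat_Cons_pos[of k "[]" i j]
  by (intro exI[of _ "[k]"]) auto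

lemma invariant_sets_closed_class:
  assumes "C \<in> classes A P" "closed_class A P C"
  shows "invariant_sets (\<lambda>_. C)"
proof -
  have "C \<noteq> {}" using assms(1) reach_refl unfolding classes_iff by blast
  then show ?thesis
    using assms(2) reach_step unfolding invariant_sets_def closed_class_iff by blast
qed

text \<open>Words from \<open>i\<close> to the same state have depths that agree modulo the period
  \<open>D\<close>, so the depth modulo \<open>D\<close> labels the states of \<open>R\<close>. A
  step by \<open>k\<close> raises both the site and the label by \<open>k\<close>, which leaves the
  label at site 0 free among the multiples of \<open>Gcd A\<close>.\<close>

lemma invariant_sets_periodic:
  assumes R: "R \<in> classes A P" "closed_class A P R" "i \<in> R"
    and ap: "Gcd (return_depths i) \<noteq> Gcd A"
  shows "\<exists>V V'. invariant_sets V \<and> invariant_sets V' \<and> V 0 \<inter> V' 0 = {}"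
proof -
  define D d where "D = Gcd (return_depths i)" and "d = Gcd A"
  have dD: "d dvd D" unfolding D_def d_def
    by (rule Gcd_greatest) (auto simp: return_depths_def words_def intro: sum_list_dvd)
  have Dpos: "D > 0" unfolding D_def using Gcd_return_depths_pos[OF R] .
  \<comment> \<open>\<open>V s\<close> prescribes the cyclic class of the state at every site; as \<open>D\<close> is a proper multiple
    of \<open>d\<close>, shifting the prescription by \<open>d\<close> gives a second, disjoint one.\<close>
  define V where "V s n = {j. \<exists>a. set a \<subseteq> A \<and> word_mat P a i j > 0 \<and>
      int D dvd int (depth a) - (n - n mod int d + int s)}" for s :: nat and n :: int
  have inv: "invariant_sets (V s)" if s: "d dvd s" for s
    unfolding invariant_sets_def
  proof (intro conjI allI ballI impI)
    fix n k j j' assume k: "k \<in> A" and j: "j \<in> V s (n - int k)" and p: "P k j j' > 0"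
    obtain a where a: "set a \<subseteq> A" "word_mat P a i j > 0"
        "int D dvd int (depth a) - (n - int k - (n - int k) mod int d + int s)"
      using j unfolding V_def by blast
    \<comment> \<open>Letters are multiples of \<open>d\<close>, so rounding the site down to a
      multiple of \<open>d\<close> commutes with the step, and depth and prescription both grow by
      \<open>k\<close>.\<close>
    have "d dvd k" using k d_def by simp
    then have "(n - int k) mod int d = n mod int d"
      by (metis diff_zero int_dvd_int_iff mod_0_imp_dvd mod_diff_right_eq dvd_imp_mod_0)
    then have "int (depth (k # a)) - (n - n mod int d + int s)
        = int (depth a) - (n - int k - (n - int k) mod int d + int s)" by (simp add: depth_def)
    then have "int D dvd int (depth (k # a)) - (n - n mod int d + int s)" using a(3) by (simp only:)
    moreover have "word_mat P (k # a) i j' > 0" using word_mat_Cons_pos[of k a i j'] a k p by blast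
    moreover have "set (k # a) \<subseteq> A" using a k by simp
    ultimately show "j' \<in> V s n" unfolding V_def by blast
  next
    fix n
    \<comment> \<open>Nonemptiness asks for a word whose depth has the prescribed residue modulo
      \<open>D\<close>. The depths of all words form an additive set with gcd \<open>d\<close>, so
      every large multiple of \<open>d\<close> occurs.\<close>
    define S where "S = depth ` {a. a \<in> words A}"
    have S: "x + y \<in> S" if xy: "x \<in> S" "y \<in> S" for x y
    proof -
      obtain a b where "a \<in> words A" "b \<in> words A" "x = depth a" "y = depth b"
        using xy unfolding S_def by blast
      then have "a @ b \<in> words A" "x + y = depth (a @ b)" by (auto simp: words_def depth_def)
      then show ?thesis unfolding S_def by blast
    qed
    have GS: "Gcd S = d"
    proof (rule dvd_antisym)
      show "Gcd S dvd d" unfolding d_def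
      proof (rule Gcd_greatest)
        fix k assume "k \<in> A"
        then have "[k] \<in> words A" "depth [k] = k" by (auto simp: words_def depth_def)
        then have "k \<in> S" unfolding S_def by force
        then show "Gcd S dvd k" by simp
      qed
      show "d dvd Gcd S" unfolding d_def S_def
        by (rule Gcd_greatest) (auto simp: words_def intro: sum_list_dvd)
    qed
    have "Gcd S > 0" using GS Gcd_A_pos d_def by simp
    then obtain N where N: "\<And>m. m \<ge> N \<Longrightarrow> d dvd m \<Longrightarrow> m \<in> S"
      using additive_contains_large_multiples[OF S] GS by blast
    define z where "z = n - n mod int d + int s"
    have "int d dvd z" unfolding z_def using s by (simp add: minus_mod_eq_mult_div)
    \<comment> \<open>\<open>m\<close> is congruent to \<open>z\<close> modulo \<open>D\<close>; the
      summand \<open>D * N\<close> lifts it to the range where all multiples of \<open>d\<close> are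
      depths.\<close>
    define m where "m = nat (z mod int D) + D * N"
    have m: "int m = z mod int D + int D * int N" unfolding m_def using Dpos by simp
    have "int d dvd int m" unfolding m using \<open>int d dvd z\<close> dD
      by (meson dvd_add dvd_mod dvd_mult2 int_dvd_int_iff)
    then have dm: "d dvd m" by simp
    have "m \<ge> N" unfolding m_def using Dpos
      by (metis One_nat_def Suc_leI mult_le_mono1 nat_mult_1 trans_le_add2)
    then have "m \<in> S" using N dm by blast
    then obtain a where a: "a \<in> words A" "depth a = m" unfolding S_def by blast
    obtain j where "word_mat P a i j > 0" using word_mat_ex_pos[of a i] a by (auto simp: words_def)
    moreover have "int D dvd int m - z"
      unfolding m by (metis add_diff_eq diff_add_eq dvd_add_left_iff dvd_diff_commute dvd_minus_mod dvd_triv_left)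
    ultimately have "j \<in> V s n" unfolding V_def using a by (auto simp: z_def words_def)
    then show "V s n \<noteq> {}" by blast
  qed
  have "V 0 0 \<inter> V d 0 = {}"
  proof (rule ccontr)
    assume "V 0 0 \<inter> V d 0 \<noteq> {}"
    then obtain j a b where a: "set a \<subseteq> A" "word_mat P a i j > 0" "int D dvd int (depth a)"
      and b: "set b \<subseteq> A" "word_mat P b i j > 0" "int D dvd int (depth b) - int d"
      unfolding V_def by auto
    have "reach i j" using a unfolding reach_def by blast
    then have "j \<in> R" using R closed_class_iff by blast
    then have "reach j i" using R class_reach by blast
    then obtain c where c: "set c \<subseteq> A" "word_mat P c j i > 0" unfolding reach_def by blast
    \<comment> \<open>One word \<open>c\<close> back from \<open>j\<close> closes every word from
      \<open>i\<close> to \<open>j\<close> into a loop, whose depth is a multiple of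
      \<open>D\<close>; comparing the loops through \<open>a\<close> and \<open>b\<close> gives
      \<open>D dvd d\<close>.\<close>
    have ret: "D dvd depth c + depth a'" if "set a' \<subseteq> A" "word_mat P a' i j > 0" for a'
    proof (cases "c @ a' = []")
      case False
      then have "depth c + depth a' \<in> return_depths i"
        unfolding return_depths_def using word_mat_append_pos[OF that(1) c(1) that(2) c(2)] that c
        by (auto simp: words_def depth_def intro!: exI[of _ "c @ a'"])
      then show ?thesis unfolding D_def by simp
    qed (auto simp: depth_def)
    have "D dvd depth c" using ret[OF a(1,2)] a(3) by (simp add: dvd_add_left_iff)
    then have "D dvd depth b" using ret[OF b(1,2)] by (simp add: dvd_add_right_iff)
    then have "int D dvd int d" using b(3)
      by (metis dvd_diff_right_iff int_dvd_int_iff)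
    then have "D dvd d" by simp
    then show False using dD ap dvd_antisym unfolding D_def d_def by blast
  qed
  moreover have "invariant_sets (V 0)" "invariant_sets (V d)" using inv by auto
  ultimately show ?thesis by blast
qed

end

section \<open>Laws on path space\<close>

definition cyl :: "(int \<times> 'g) list \<Rightarrow> (int \<Rightarrow> 'g) set" where
  "cyl l = {x. \<forall>(n, g)\<in>set l. x n = g}"

text \<open>A list may name the same site repeatedly; two factors at one site express two lines that
  have met.\<close>

definition ev :: "(int \<times> ('g \<Rightarrow> real)) list \<Rightarrow> (int \<Rightarrow> 'g) \<Rightarrow> real" where
  "ev l x = (\<Prod>(n, f)\<leftarrow>l. f (x n))"

lemma ev_Nil [simp]: "ev [] x = 1"
  and ev_Cons [simp]: "ev ((n, f) # l) x = f (x n) * ev l x"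
  by (simp_all add: ev_def)

lemma ev_Cons_fun: "ev ((n, f) # l) = (\<lambda>x. f (x n) * ev l x)"
  by (rule ext) simp

lemma ev_Nil_fun: "ev [] = (\<lambda>x. 1)"
  by (rule ext) simp

lemma ev_cong_mset:
  assumes "mset l = mset l'"
  shows "ev l = ev l'"
proof
  fix x
  have "mset (map (\<lambda>(n, f). f (x n)) l) = mset (map (\<lambda>(n, f). f (x n)) l')"
    using assms by simp
  then show "ev l x = ev l' x"
    unfolding ev_def by (metis prod_mset_prod_list)
qed

lemma ev_bounded:
  fixes l :: "(int \<times> ('g::finite \<Rightarrow> real)) list"
  shows "\<exists>B\<ge>0. \<forall>x. \<bar>ev l x\<bar> \<le> B"
proof (induction l)
  case (Cons p l)
  obtain n f where p: "p = (n, f)" by force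
  obtain B where B: "B \<ge> 0" "\<And>x. \<bar>ev l x\<bar> \<le> B" using Cons by blast
  define S where "S = (\<Sum>g\<in>UNIV. \<bar>f g\<bar>)"
  have "\<bar>f g\<bar> \<le> S" for g unfolding S_def by (rule member_le_sum) auto
  then have "\<bar>ev (p # l) x\<bar> \<le> S * B" for x
    unfolding p using B by (simp add: abs_mult mult_mono')
  moreover have "S * B \<ge> 0" using B(1) by (simp add: S_def sum_nonneg)
  ultimately show ?case by blast
qed (auto intro: exI[of _ 1])

lemma ev_indicators:
  "ev (map (\<lambda>(n, g). (n, \<lambda>h. of_bool (h = g))) l) x = indicator (cyl l) x"
proof (induction l)
  case (Cons p l)
  obtain n g where p: "p = (n, g)" by force
  show ?case unfolding p using Cons by (simp add: cyl_def indicator_def)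
qed (simp add: cyl_def)

lemma cyl_Int: "cyl l \<inter> cyl l' = cyl (l @ l')"
  unfolding cyl_def set_append ball_Un by (rule Collect_conj_eq[symmetric])

text \<open>As the state space is finite, an event at one site is a finite union of one-site
  cylinders. The predicate \<open>Q\<close> serves both the full sigma-algebra and the past of a
  site.\<close>

lemma sigma_sets_cyl:
  fixes Q :: "int \<Rightarrow> bool"
  shows "sigma_sets UNIV {{x. x m \<in> B} | m (B :: 'g::finite set). Q m}
    = sigma_sets UNIV {cyl l | l. \<forall>(m, g)\<in>set l. Q m}" (is "sigma_sets _ ?E = sigma_sets _ ?C")
proof (rule sigma_sets_eqI)
  fix X assume "X \<in> ?E"
  then obtain m B where X: "X = {x. x m \<in> B}" "Q m" by blast
  have "X = (\<Union>b\<in>B. cyl [(m, b)])" unfolding X(1) by (auto simp: cyl_def)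
  moreover have "cyl [(m, b)] \<in> sigma_sets UNIV ?C" for b
    using X(2) by (intro sigma_sets.Basic) force
  ultimately show "X \<in> sigma_sets UNIV ?C"
    using sigma_algebra.axioms(1)[OF sigma_algebra_sigma_sets, THEN algebra.axioms(1), of ?C UNIV,
        THEN ring_of_sets.finite_UN, of B "\<lambda>b. cyl [(m, b)]"]
    by (simp add: finite_subset[OF subset_UNIV])
next
  fix X assume "X \<in> ?C"
  then obtain l where X: "X = cyl l" "\<forall>(m, g)\<in>set l. Q m" by blast
  interpret sigma_algebra UNIV "sigma_sets UNIV ?E" by (rule sigma_algebra_sigma_sets) simp
  have "cyl l \<in> sigma_sets UNIV ?E" using X(2)
  proof (induction l)
    case Nil
    then show ?case using top by (simp add: cyl_def)
  next
    case (Cons p l)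
    obtain n g where p: "p = (n, g)" by force
    have "cyl (p # l) = {x. x n \<in> {g}} \<inter> cyl l" unfolding p cyl_def by auto
    moreover have "{x. x n \<in> {g}} \<in> sigma_sets UNIV ?E"
      using Cons.prems p by (intro sigma_sets.Basic) force
    moreover have "cyl l \<in> sigma_sets UNIV ?E" using Cons by simp
    ultimately show ?case by (simp only: Int)
  qed
  then show "X \<in> sigma_sets UNIV ?E" using X by simp
qed

lemma space_pathspace: "space pathspace = UNIV"
  by (simp add: pathspace_def space_PiM)

lemma sets_pathspace:
  "sets (pathspace :: (int \<Rightarrow> 'g::finite) measure) = sigma_sets UNIV (range cyl)"
proof -
  have "sets (pathspace :: (int \<Rightarrow> 'g) measure) = sigma_sets UNIV {{x. x m \<in> B} | m B. True}"
    unfolding pathspace_def sets_PiM_single by simp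
  also have "\<dots> = sigma_sets UNIV (range cyl)"
    unfolding sigma_sets_cyl by (simp add: full_SetCompr_eq)
  finally show ?thesis .
qed

lemma law_eqI:
  fixes M N :: "(int \<Rightarrow> 'g::finite) measure"
  assumes "prob_space M" "sets M = sets pathspace" "prob_space N" "sets N = sets pathspace"
    and eq: "\<And>l. measure M (cyl l) = measure N (cyl l)"
  shows "M = N"
proof (rule measure_eqI_generator_eq[where E = "range cyl" and A = "\<lambda>_. UNIV" and \<Omega> = UNIV])
  interpret M: prob_space M by fact
  interpret N: prob_space N by fact
  show "Int_stable (range (cyl :: (int \<times> 'g) list \<Rightarrow> _))" by (auto simp: Int_stable_def cyl_Int)
  show "emeasure M X = emeasure N X" if "X \<in> range cyl" for X
    using that eq by (auto simp: M.emeasure_eq_measure N.emeasure_eq_measure)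
  show "sets M = sigma_sets UNIV (range cyl)" "sets N = sigma_sets UNIV (range cyl)"
    using assms by (simp_all add: sets_pathspace)
  show "range (\<lambda>_::nat. UNIV) \<subseteq> range (cyl :: (int \<times> 'g) list \<Rightarrow> _)"
    by (auto intro: range_eqI[of _ _ "[]"] simp: cyl_def)
qed (auto simp: prob_space.emeasure_space_1 finite_measure.emeasure_finite prob_space.finite_measure assms)

locale path_law = prob_space M for M :: "(int \<Rightarrow> 'g::finite) measure" +
  assumes sets_M: "sets M = sets pathspace"
begin

lemma space_M: "space M = UNIV"
  using sets_eq_imp_space_eq[OF sets_M] by (simp add: space_pathspace)

lemma measurable_site [measurable]: "(\<lambda>x. x n) \<in> measurable M (count_space UNIV)"
  unfolding measurable_cong_sets[OF sets_M refl] pathspace_def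
  by (rule measurable_component_singleton) simp

lemma measurable_site_fun [measurable]: "(\<lambda>x. f (x n) :: real) \<in> borel_measurable M"
  by (rule measurable_compose[OF measurable_site]) simp

lemma measurable_ev [measurable]: "ev l \<in> borel_measurable M"
  by (induction l) (auto simp: ev_def case_prod_beta)

lemma cyl_sets [measurable]: "cyl l \<in> sets M"
  unfolding sets_M sets_pathspace by (rule sigma_sets.Basic) simp

lemma integrable_bounded:
  fixes f :: "(int \<Rightarrow> 'g) \<Rightarrow> real"
  assumes "f \<in> borel_measurable M" "\<And>x. \<bar>f x\<bar> \<le> B"
  shows "integrable M f"
  using assms by (intro integrable_const_bound[of _ B]) auto

lemma integrable_ev: "integrable M (ev l)"
proof -
  obtain B where "\<And>x. \<bar>ev l x\<bar> \<le> B" using ev_bounded[of l] by blast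
  then show ?thesis by (rule integrable_bounded[OF measurable_ev])
qed

lemma integrable_cyl: "integrable M (indicator (cyl l) :: _ \<Rightarrow> real)"
  by (rule integrable_bounded[of _ 1]) (auto simp: indicator_def)

lemma sets_past_alg: "sets (past_alg M n) = sigma_sets UNIV {cyl l | l. \<forall>(m, g)\<in>set l. m < n}"
proof -
  have "sets (past_alg M n) = sigma_sets UNIV {{x. x m \<in> B} | m B. m < n}"
    unfolding past_alg_def space_M by (simp add: sets_measure_of_conv)
  then show ?thesis by (simp only: sigma_sets_cyl)
qed

lemma space_past_alg: "space (past_alg M n) = UNIV"
  unfolding past_alg_def space_M by (simp add: space_measure_of_conv)

lemma subalgebra_past_alg: "subalgebra M (past_alg M n)"
proof -
  have "sigma_sets UNIV {cyl l | l :: (int \<times> 'g) list. \<forall>(m, g)\<in>set l. m < n} \<subseteq> sigma_sets UNIV (range cyl)"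
    by (rule sigma_sets_mono') auto
  then show ?thesis
    unfolding subalgebra_def by (simp add: space_past_alg space_M sets_past_alg sets_M sets_pathspace)
qed

sublocale past: finite_measure_subalgebra M "past_alg M n" for n
  by unfold_locales (rule subalgebra_past_alg)

lemma measurable_past_site: "m < n \<Longrightarrow> (\<lambda>x. x m) \<in> measurable (past_alg M n) (count_space UNIV)"
proof (rule measurableI)
  fix B :: "'g set" assume "m < n"
  then have "{x. x m \<in> B} \<in> sigma_sets UNIV {{x. x m \<in> B} | m B. m < n}"
    by (intro sigma_sets.Basic) blast
  then show "(\<lambda>x. x m) -` B \<inter> space (past_alg M n) \<in> sets (past_alg M n)"
    by (simp add: space_past_alg sets_past_alg sigma_sets_cyl[symmetric] vimage_def)
qed simp

lemma measurable_past_site_fun: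
  "m < n \<Longrightarrow> (\<lambda>x. f (x m) :: real) \<in> borel_measurable (past_alg M n)"
  by (rule measurable_compose[OF measurable_past_site]) auto

lemma measurable_past_ev:
  "\<forall>(m, f)\<in>set l. m < n \<Longrightarrow> ev l \<in> borel_measurable (past_alg M n)"
proof (induction l)
  case (Cons p l)
  obtain m f where p: "p = (m, f)" by force
  have "(\<lambda>x. f (x m)) \<in> borel_measurable (past_alg M n)"
    using Cons.prems p by (intro measurable_past_site_fun) auto
  moreover have "ev l \<in> borel_measurable (past_alg M n)" using Cons by simp
  ultimately have "(\<lambda>x. f (x m) * ev l x) \<in> borel_measurable (past_alg M n)"
    by (rule borel_measurable_times)
  then show ?case by (simp add: p ev_Cons_fun)
qed (simp add: ev_Nil_fun)

end

context imitation
begin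

text \<open>Extension by 0 turns sums over \<open>A\<close> into series over all naturals.\<close>

definition th :: "nat \<Rightarrow> real" where
  "th k = (if k \<in> A then \<theta> k else 0)"

lemma th_nonneg: "th k \<ge> 0"
  using theta_pos[of k] by (auto simp: th_def)

lemma th_sums: "th sums 1"
proof -
  have "(th has_sum 1) UNIV"
    using theta_prob by (rule has_sum_cong_neutral[THEN iffD1, rotated -1]) (auto simp: th_def)
  then show ?thesis by (rule has_sum_imp_sums)
qed

lemma P_le_1: "k \<in> A \<Longrightarrow> P k i j \<le> 1"
  using member_le_sum[of j UNIV "P k i"] P_nonneg P_sum by auto

lemma th_P_bound: "\<bar>th k * (P k i j * z)\<bar> \<le> th k * \<bar>z\<bar>"
proof (cases "k \<in> A")
  case True
  then have "\<bar>P k i j * z\<bar> \<le> 1 * \<bar>z\<bar>"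
    using P_nonneg[OF True] P_le_1[OF True] unfolding abs_mult by (intro mult_right_mono) auto
  then show ?thesis using th_nonneg[of k] by (simp add: abs_mult mult_left_mono)
qed (simp add: th_def)

definition kernel :: "'g \<Rightarrow> (nat \<Rightarrow> 'g) \<Rightarrow> real" where
  "kernel = imitation_kernel A \<theta> P"

lemma kernel_sums: "(\<lambda>k. th k * P k (w k) g) sums kernel g w"
proof -
  have "(\<lambda>k. \<theta> k * P k (w k) g) summable_on A"
  proof (rule summable_on_comparison_test)
    show "\<theta> summable_on A" using theta_prob by (rule has_sum_imp_summable)
    show "\<theta> k * P k (w k) g \<le> \<theta> k" if "k \<in> A" for k
      using theta_pos[OF that] P_le_1[OF that] by simp
    show "0 \<le> \<theta> k * P k (w k) g" if "k \<in> A" for k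
      using theta_pos[OF that] P_nonneg[OF that] by simp
  qed
  then have "((\<lambda>k. \<theta> k * P k (w k) g) has_sum kernel g w) A"
    unfolding kernel_def imitation_kernel_def by (rule has_sum_infsum)
  then have "((\<lambda>k. th k * P k (w k) g) has_sum kernel g w) UNIV"
    by (rule has_sum_cong_neutral[THEN iffD1, rotated -1]) (auto simp: th_def)
  then show ?thesis by (rule has_sum_imp_sums)
qed

lemma kernel_nonneg: "kernel g w \<ge> 0"
proof (rule sums_le[OF _ sums_zero kernel_sums])
  show "0 \<le> th k * P k (w k) g" for k
    using P_nonneg[of k] theta_pos[of k] by (auto simp: th_def)
qed

lemma kernel_sum: "(\<Sum>g\<in>UNIV. kernel g w) = 1"
proof (rule sums_unique2)
  show "(\<lambda>k. \<Sum>g\<in>UNIV. th k * P k (w k) g) sums (\<Sum>g\<in>UNIV. kernel g w)"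
    by (rule sums_sum) (rule kernel_sums)
  have "(\<Sum>g\<in>UNIV. th k * P k (w k) g) = th k" for k
    using P_sum[of k] by (cases "k \<in> A") (auto simp: th_def sum_distrib_left[symmetric])
  then show "(\<lambda>k. \<Sum>g\<in>UNIV. th k * P k (w k) g) sums 1" using th_sums by simp
qed

lemma kernel_le_1: "kernel g w \<le> 1"
  using member_le_sum[of g UNIV "\<lambda>g. kernel g w"] kernel_nonneg kernel_sum by auto

definition app :: "nat \<Rightarrow> ('g \<Rightarrow> real) \<Rightarrow> 'g \<Rightarrow> real" where
  "app k f i = (\<Sum>j\<in>UNIV. P k i j * f j)"

end

locale imitation_law = imitation A \<theta> P + path_law M
  for A \<theta> and P :: "nat \<Rightarrow> 'g::finite \<Rightarrow> 'g \<Rightarrow> real" and M :: "(int \<Rightarrow> 'g) measure"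
begin

lemma measurable_kernel:
  "(\<lambda>x. kernel g (\<lambda>k. x (n - int k))) \<in> borel_measurable (past_alg M n)"
proof -
  have "(\<lambda>x. th k * P k (x (n - int k)) g) \<in> borel_measurable (past_alg M n)" for k
  proof (cases "k \<in> A")
    case True
    then have "k \<noteq> 0" using zero_notin_A by metis
    then show ?thesis
      by (intro borel_measurable_times borel_measurable_const measurable_past_site_fun) simp
  qed (simp add: th_def)
  then have "(\<lambda>x. \<Sum>k. th k * P k (x (n - int k)) g) \<in> borel_measurable (past_alg M n)"
    by (rule borel_measurable_suminf)
  then show ?thesis by (simp only: kernel_sums[THEN sums_unique, symmetric])
qed

lemma integral_kernel_sums:
  "(\<lambda>k. th k * (\<integral>x. P k (x (n - int k)) g * ev l x \<partial>M))
    sums (\<integral>x. kernel g (\<lambda>k. x (n - int k)) * ev l x \<partial>M)"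
proof -
  obtain B where B: "B \<ge> 0" "\<And>x. \<bar>ev l x\<bar> \<le> B" using ev_bounded[of l] by blast
  have bd: "\<bar>th k * (P k (x (n - int k)) g * ev l x)\<bar> \<le> th k * B" for k x
    by (rule order_trans[OF th_P_bound]) (simp add: B th_nonneg mult_left_mono)
  have int: "integrable M (\<lambda>x. th k * (P k (x (n - int k)) g * ev l x))" for k
    using bd by (intro integrable_bounded[of _ "th k * B"]) auto
  have sB: "summable (\<lambda>k. th k * B)" using th_sums by (intro summable_mult2) (rule sums_summable)
  have "(\<lambda>k. \<integral>x. th k * (P k (x (n - int k)) g * ev l x) \<partial>M)
    sums (\<integral>x. (\<Sum>k. th k * (P k (x (n - int k)) g * ev l x)) \<partial>M)"
  proof (rule sums_integral)
    show "AE x in M. summable (\<lambda>k. norm (th k * (P k (x (n - int k)) g * ev l x)))"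
      using bd by (intro AE_I2 summable_comparison_test'[OF sB]) auto
    have "(\<integral>x. norm (th k * (P k (x (n - int k)) g * ev l x)) \<partial>M) \<le> th k * B" for k
      using bd by (intro integral_le_const integrable_norm int AE_I2) auto
    then show "summable (\<lambda>k. \<integral>x. norm (th k * (P k (x (n - int k)) g * ev l x)) \<partial>M)"
      by (intro summable_comparison_test'[OF sB]) (simp add: integral_nonneg_AE)
  qed (rule int)
  moreover have "(\<Sum>k. th k * (P k (x (n - int k)) g * ev l x)) = kernel g (\<lambda>k. x (n - int k)) * ev l x" for x
    using sums_unique[OF sums_mult2[OF kernel_sums[of "\<lambda>k. x (n - int k)" g], of "ev l x"]]
    by (simp add: mult.assoc)
  ultimately show ?thesis by simp
qed

text \<open>Since \<open>ev l\<close> is measurable with respect to the past of \<open>n\<close>,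
  the indicator of \<open>x n = g\<close> may be replaced by the kernel under the integral. Writing
  \<open>f\<close> through these indicators and expanding the kernel over letters reassembles
  \<open>app k f\<close>.\<close>

lemma compatible_integral_sums:
  assumes c: "compatible kernel M" and l: "\<forall>(m, h)\<in>set l. m < n"
  shows "(\<lambda>k. th k * (\<integral>x. ev ((n - int k, app k f) # l) x \<partial>M)) sums (\<integral>x. ev ((n, f) # l) x \<partial>M)"
proof -
  obtain B where B: "B \<ge> 0" "\<And>x. \<bar>ev l x\<bar> \<le> B" using ev_bounded[of l] by blast
  have e: "(\<integral>x. indicator {y. y n = g} x * ev l x \<partial>M)
      = (\<integral>x. kernel g (\<lambda>k. x (n - int k)) * ev l x \<partial>M)" for g
  proof -
    have [measurable]: "indicator {y. y n = g} \<in> borel_measurable M"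
      using measurable_site_fun[of "indicator {g}" n] by (simp add: indicator_def of_bool_def cong: measurable_cong)
    have "\<bar>ev l x * indicator {y. y n = g} x\<bar> \<le> B" for x
      using B by (auto simp: indicator_def)
    then have "integrable M (\<lambda>x. ev l x * indicator {y. y n = g} x)"
      by (intro integrable_bounded[of _ B]) measurable
    then have "(\<integral>x. ev l x * real_cond_exp M (past_alg M n) (indicator {y. y n = g}) x \<partial>M)
        = (\<integral>x. ev l x * indicator {y. y n = g} x \<partial>M)"
      using measurable_past_ev[OF l] by (intro past.real_cond_exp_intg) auto
    moreover have "(\<integral>x. ev l x * real_cond_exp M (past_alg M n) (indicator {y. y n = g}) x \<partial>M)
        = (\<integral>x. ev l x * kernel g (\<lambda>k. x (n - int k)) \<partial>M)"
    proof (rule integral_cong_AE)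
      have "AE x in M. real_cond_exp M (past_alg M n) (indicator {y. y n = g}) x = kernel g (\<lambda>k. x (n - int k))"
        using c unfolding compatible_def by blast
      then show "AE x in M. ev l x * real_cond_exp M (past_alg M n) (indicator {y. y n = g}) x
          = ev l x * kernel g (\<lambda>k. x (n - int k))"
        by eventually_elim simp
      have "(\<lambda>x. kernel g (\<lambda>k. x (n - int k))) \<in> borel_measurable M"
        using measurable_kernel by (rule measurable_from_subalg[OF subalgebra_past_alg])
      then show "(\<lambda>x. ev l x * kernel g (\<lambda>k. x (n - int k))) \<in> borel_measurable M" by measurable
    qed measurable
    ultimately show ?thesis by (simp add: mult.commute)
  qed
  have I: "integrable M (\<lambda>x. h (x m) * ev l x)" for h :: "'g \<Rightarrow> real" and m
    using integrable_ev[of "(m, h) # l"] unfolding ev_Cons_fun .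
  have lhs: "(\<integral>x. ev ((n, f) # l) x \<partial>M) = (\<Sum>g\<in>UNIV. f g * (\<integral>x. indicator {y. y n = g} x * ev l x \<partial>M))"
  proof -
    have "f g * (indicator {y. y n = g} x * ev l x) = (if g = x n then f (x n) * ev l x else 0)" for g x
      by (auto simp: indicator_def)
    then have "f (x n) * ev l x = (\<Sum>g\<in>UNIV. f g * (indicator {y. y n = g} x * ev l x))" for x
      by simp
    moreover have "integrable M (\<lambda>x. indicator {y. y n = g} x * ev l x)" for g
      using I[of "indicator {g}" n] by (simp add: indicator_def of_bool_def cong: integrable_cong)
    ultimately show ?thesis by simp
  qed
  have "(\<lambda>k. \<Sum>g\<in>UNIV. f g * (th k * (\<integral>x. P k (x (n - int k)) g * ev l x \<partial>M)))
    sums (\<Sum>g\<in>UNIV. f g * (\<integral>x. kernel g (\<lambda>k. x (n - int k)) * ev l x \<partial>M))"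
    by (intro sums_sum sums_mult integral_kernel_sums)
  moreover have "(\<Sum>g\<in>UNIV. f g * (th k * (\<integral>x. P k (x (n - int k)) g * ev l x \<partial>M)))
     = th k * (\<integral>x. ev ((n - int k, app k f) # l) x \<partial>M)" for k
  proof -
    have "app k f (x (n - int k)) * ev l x = (\<Sum>g\<in>UNIV. f g * (P k (x (n - int k)) g * ev l x))" for x
      unfolding app_def sum_distrib_right by (rule sum.cong) (simp_all add: mult_ac)
    moreover have "integrable M (\<lambda>x. P k (x (n - int k)) g * ev l x)" for g
      by (rule I[of "\<lambda>i. P k i g"])
    ultimately have "(\<integral>x. ev ((n - int k, app k f) # l) x \<partial>M)
        = (\<Sum>g\<in>UNIV. f g * (\<integral>x. P k (x (n - int k)) g * ev l x \<partial>M))"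
      by simp
    then show ?thesis by (simp add: sum_distrib_left mult_ac)
  qed
  ultimately show ?thesis unfolding lhs e by simp
qed

text \<open>Past cylinders are stable under intersection and generate the past, so the identity
  characterizing the conditional expectation extends from them to the whole past by the Dynkin
  argument.\<close>

lemma compatibleI:
  assumes eq: "\<And>n g l. \<forall>(m, h)\<in>set l. m < n \<Longrightarrow>
    (\<lambda>k. th k * (\<Sum>i\<in>UNIV. P k i g * measure M (cyl ((n - int k, i) # l))))
      sums measure M (cyl ((n, g) # l))"
  shows "compatible kernel M"
  unfolding compatible_def
proof (intro conjI allI)
  show "prob_space M" by unfold_locales
  show "sets M = sets pathspace" by (rule sets_M)
  fix n g
  let ?f = "indicator {y. y n = g} :: (int \<Rightarrow> 'g) \<Rightarrow> real"
  let ?p = "\<lambda>x. kernel g (\<lambda>k. x (n - int k))"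
  have fE: "?f = indicator (cyl [(n, g)])" by (auto simp: cyl_def indicator_def)
  have If: "integrable M ?f" unfolding fE by (rule integrable_bounded[of _ 1]) (auto simp: indicator_def)
  have pM: "?p \<in> borel_measurable M"
    using measurable_kernel by (rule measurable_from_subalg[OF subalgebra_past_alg])
  have Ip: "integrable M ?p"
    using kernel_nonneg kernel_le_1 by (intro integrable_bounded[OF pM, of 1]) (auto simp: abs_le_iff intro: order_trans)
  \<comment> \<open>On a past cylinder the assumed series is the integral of the kernel, expanded
    over letters.\<close>
  have cylE: "(\<integral>x\<in>cyl l. ?f x \<partial>M) = (\<integral>x\<in>cyl l. ?p x \<partial>M)" if l: "\<forall>(m, h)\<in>set l. m < n" for l
  proof -
    define el where "el = map (\<lambda>(n, g). (n :: int, \<lambda>h :: 'g. of_bool (h = g) :: real)) l"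
    have el: "ev el = indicator (cyl l)" unfolding el_def using ev_indicators by blast
    have "(\<integral>x. P k (x m) g * ev el x \<partial>M) = (\<Sum>i\<in>UNIV. P k i g * measure M (cyl ((m, i) # l)))" for k m
    proof -
      have "P k (x m) g * ev el x = (\<Sum>i\<in>UNIV. P k i g * indicator (cyl ((m, i) # l)) x)" for x
      proof -
        have "indicator (cyl ((m, i) # l)) x = (if i = x m then indicator (cyl l) x else 0 :: real)" for i
          by (auto simp: cyl_def indicator_def)
        then show ?thesis unfolding el
          by (simp add: if_distrib[of "\<lambda>z. _ * z"] cong: if_cong)
      qed
      then have "(\<integral>x. P k (x m) g * ev el x \<partial>M)
          = (\<integral>x. (\<Sum>i\<in>UNIV. P k i g * indicator (cyl ((m, i) # l)) x) \<partial>M)" by (simp only:)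
      also have "\<dots> = (\<Sum>i\<in>UNIV. \<integral>x. P k i g * indicator (cyl ((m, i) # l)) x \<partial>M)"
        by (rule Bochner_Integration.integral_sum) (simp add: integrable_cyl)
      finally show ?thesis by simp
    qed
    then have "(\<lambda>k. th k * (\<integral>x. P k (x (n - int k)) g * ev el x \<partial>M)) sums measure M (cyl ((n, g) # l))"
      using eq[OF l, of g] by simp
    then have "(\<integral>x. ?p x * ev el x \<partial>M) = measure M (cyl ((n, g) # l))"
      using integral_kernel_sums sums_unique2 by blast
    moreover have "(\<integral>x\<in>cyl l. ?f x \<partial>M) = measure M (cyl ((n, g) # l))"
    proof -
      have "indicator (cyl l) x *\<^sub>R ?f x = indicator (cyl ((n, g) # l)) x" for x
        by (auto simp: cyl_def indicator_def)
      then show ?thesis unfolding set_lebesgue_integral_def by simp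
    qed
    ultimately show ?thesis unfolding set_lebesgue_integral_def el by (simp add: mult.commute)
  qed
  show "AE x in M. real_cond_exp M (past_alg M n) ?f x = ?p x"
  proof (rule past.real_cond_exp_charact[OF _ If Ip measurable_kernel])
    fix X assume "X \<in> sets (past_alg M n)"
    then have X: "X \<in> sigma_sets UNIV {cyl l | l. \<forall>(m, g)\<in>set l. m < n}"
      by (simp add: sets_past_alg)
    have stable: "Int_stable {cyl l | l :: (int \<times> 'g) list. \<forall>(m, g)\<in>set l. m < n}"
    proof (rule Int_stableI)
      fix X Y :: "(int \<Rightarrow> 'g) set"
      assume "X \<in> {cyl l | l. \<forall>(m, g)\<in>set l. m < n}" "Y \<in> {cyl l | l. \<forall>(m, g)\<in>set l. m < n}"
      then obtain l l' where "X = cyl l" "\<forall>(m, g)\<in>set l. m < n" "Y = cyl l'" "\<forall>(m, g)\<in>set l'. m < n"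
        by blast
      then have "X \<inter> Y = cyl (l @ l')" "\<forall>(m, g)\<in>set (l @ l'). m < n"
        unfolding set_append ball_Un by (simp_all only: cyl_Int)
      then show "X \<inter> Y \<in> {cyl l | l. \<forall>(m, g)\<in>set l. m < n}" by blast
    qed
    have "{cyl l | l :: (int \<times> 'g) list. \<forall>(m, g)\<in>set l. m < n} \<subseteq> Pow UNIV" by simp
    from stable this X show "(\<integral>x\<in>X. ?f x \<partial>M) = (\<integral>x\<in>X. ?p x \<partial>M)"
    proof (induction rule: sigma_sets_induct_disjoint)
      case (basic X)
      then show ?case using cylE by blast
    next
      case empty
      show ?case by (simp add: set_lebesgue_integral_def)
    next
      case (compl X)
      have X: "X \<in> sets M"
        using compl(1) subalgebra_past_alg[of n] unfolding subalgebra_def sets_past_alg by blast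
      have D: "(\<integral>x\<in>UNIV - X. h x \<partial>M) = (\<integral>x. h x \<partial>M) - (\<integral>x\<in>X. h x \<partial>M)" if h: "integrable M h" for h :: "_ \<Rightarrow> real"
      proof -
        have "integrable M (\<lambda>x. indicator X x *\<^sub>R h x)" using X h by (rule integrable_mult_indicator)
        moreover have "indicator (UNIV - X) x *\<^sub>R h x = h x - indicator X x *\<^sub>R h x" for x
          by (simp add: indicator_def)
        ultimately show ?thesis unfolding set_lebesgue_integral_def using h by simp
      qed
      have "cyl [] = (UNIV :: (int \<Rightarrow> 'g) set)" by (simp add: cyl_def)
      then have "(\<integral>x. ?f x \<partial>M) = (\<integral>x. ?p x \<partial>M)"
        using cylE[of "[]"] by (simp add: set_lebesgue_integral_def)
      then show ?case using compl(2) D[OF If] D[OF Ip] by simp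
    next
      case (union X)
      have X: "X i \<in> sets M" for i
        using union(2) subalgebra_past_alg[of n] unfolding subalgebra_def sets_past_alg by blast
      have "(\<integral>x\<in>(\<Union>i. X i). h x \<partial>M) = (\<Sum>i. \<integral>x\<in>X i. h x \<partial>M)" if h: "integrable M h" for h :: "_ \<Rightarrow> real"
      proof (rule lebesgue_integral_countable_add[OF X])
        show "X i \<inter> X j = {}" if "i \<noteq> j" for i j
          using that union(1) by (simp add: disjoint_family_on_def)
        have "(\<Union>i. X i) \<in> sets M" using X by blast
        then show "set_integrable M (\<Union>i. X i) h"
          unfolding set_integrable_def using h by (rule integrable_mult_indicator)
      qed
      then show ?case using union(3) If Ip by simp
    qed
  qed
qed

end

section \<open>Contraction\<close>

definition unit_fun :: "('g \<Rightarrow> real) \<Rightarrow> bool" where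
  "unit_fun f \<longleftrightarrow> (\<forall>i. \<bar>f i\<bar> \<le> 1)"

definition unit_list :: "(int \<times> ('g \<Rightarrow> real)) list \<Rightarrow> bool" where
  "unit_list l \<longleftrightarrow> (\<forall>(n, f)\<in>set l. unit_fun f)"

lemma unit_list_simps [simp]:
  "unit_list []" "unit_list ((n, f) # l) \<longleftrightarrow> unit_fun f \<and> unit_list l"
  "unit_list (l @ l') \<longleftrightarrow> unit_list l \<and> unit_list l'"
  by (simp_all add: unit_list_def ball_Un)

context imitation
begin

lemma app_diff: "app k (\<lambda>i. f i - h i) = (\<lambda>i. app k f i - app k h i)"
  by (rule ext) (simp add: app_def algebra_simps sum_subtractf)

lemma app_const: "k \<in> A \<Longrightarrow> app k (\<lambda>_. c) = (\<lambda>_. c)"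
  using P_sum[of k] by (auto simp: fun_eq_iff app_def sum_distrib_right[symmetric])

lemma app_nonneg: "k \<in> A \<Longrightarrow> (\<And>i. f i \<ge> 0) \<Longrightarrow> app k f i \<ge> 0"
  unfolding app_def by (intro sum_nonneg mult_nonneg_nonneg P_nonneg)

lemma unit_fun_app:
  assumes k: "k \<in> A" and f: "unit_fun f"
  shows "unit_fun (app k f)"
  unfolding unit_fun_def
proof
  fix i
  have "\<bar>app k f i\<bar> \<le> (\<Sum>j\<in>UNIV. \<bar>P k i j * f j\<bar>)" unfolding app_def by (rule sum_abs)
  also have "\<dots> \<le> (\<Sum>j\<in>UNIV. P k i j * 1)"
    using f P_nonneg[OF k] unfolding unit_fun_def abs_mult by (intro sum_mono mult_mono) auto
  finally show "\<bar>app k f i\<bar> \<le> 1" using P_sum[OF k] by simp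
qed

section \<open>Expansion over words of a given depth and its minorization\<close>

text \<open>The sum of \<open>\<theta>\<^sub>a P\<^sub>a f\<close> over all words \<open>a\<close> of depth \<open>s\<close>,
  and (below) the sum of the weights \<open>\<theta>\<^sub>a\<close> alone.\<close>
function transfer :: "nat \<Rightarrow> ('g \<Rightarrow> real) \<Rightarrow> 'g \<Rightarrow> real" where
  "transfer s f i = (if s = 0 then f i else (\<Sum>k\<in>A \<inter> {1..s}. th k * transfer (s - k) (app k f) i))"
  by pat_completeness auto
termination by (relation "Wellfounded.measure (\<lambda>(s, f, i). s)") auto

function renewal :: "nat \<Rightarrow> real" where
  "renewal s = (if s = 0 then 1 else (\<Sum>k\<in>A \<inter> {1..s}. th k * renewal (s - k)))"
  by pat_completeness auto
termination by (relation "Wellfounded.measure (\<lambda>s. s)") auto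

declare transfer.simps [simp del] renewal.simps [simp del]

lemma transfer_0: "transfer 0 f = f"
  by (rule ext) (simp add: transfer.simps)

lemma transfer_rec:
  "s > 0 \<Longrightarrow> transfer s f = (\<lambda>i. \<Sum>k\<in>A \<inter> {1..s}. th k * transfer (s - k) (app k f) i)"
  by (rule ext) (simp add: transfer.simps)

lemma transfer_diff: "transfer s (\<lambda>i. f i - h i) i = transfer s f i - transfer s h i"
proof (induction s arbitrary: f h rule: less_induct)
  case (less s)
  show ?case
  proof (cases "s = 0")
    case False
    have "transfer (s - k) (app k (\<lambda>i. f i - h i)) i
        = transfer (s - k) (app k f) i - transfer (s - k) (app k h) i"
      if "k \<in> A \<inter> {1..s}" for k
      unfolding app_diff using that False by (intro less) auto
    then have "(\<Sum>k\<in>A \<inter> {1..s}. th k * transfer (s - k) (app k (\<lambda>i. f i - h i)) i)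
        = (\<Sum>k\<in>A \<inter> {1..s}. th k * transfer (s - k) (app k f) i - th k * transfer (s - k) (app k h) i)"
      by (intro sum.cong) (auto simp: right_diff_distrib)
    then show ?thesis using False
      by (simp add: transfer_rec sum_subtractf)
  qed (simp add: transfer_0)
qed

lemma transfer_one: "transfer s (\<lambda>_. 1) i = renewal s"
proof (induction s rule: less_induct)
  case (less s)
  then show ?case
    by (cases "s = 0") (auto simp: transfer_rec transfer_0 renewal.simps[of s] renewal.simps[of 0]
        app_const intro!: sum.cong)
qed

lemma transfer_nonneg: "(\<And>i. f i \<ge> 0) \<Longrightarrow> transfer s f i \<ge> 0"
proof (induction s arbitrary: f rule: less_induct)
  case (less s)
  show ?case
  proof (cases "s = 0")
    case True
    then show ?thesis using less by (simp add: transfer_0)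
  next
    case False
    have "transfer (s - k) (app k f) i \<ge> 0" if "k \<in> A \<inter> {1..s}" for k
      using that False less.prems by (intro less.IH app_nonneg) auto
    then show ?thesis using False th_nonneg by (auto simp: transfer_rec intro!: sum_nonneg mult_nonneg_nonneg)
  qed
qed

text \<open>For nonnegative \<open>f\<close> the word \<open>a\<close> contributes one of many
  nonnegative terms. The head of the list acts on \<open>f\<close> first, being the last step of the
  path.\<close>

lemma transfer_ge_word:
  assumes "set a \<subseteq> A" "\<And>i. f i \<ge> 0"
  shows "transfer (depth a) f i \<ge> (\<Prod>k\<leftarrow>a. th k) * (\<Sum>j\<in>UNIV. word_mat P a i j * f j)"
  using assms
proof (induction a arbitrary: f)
  case Nil
  have "(\<Sum>j\<in>UNIV. (if i = j then 1 else 0) * f j) = f i"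
    by (simp add: if_distrib[of "\<lambda>z. z * _"] cong: if_cong)
  then show ?case by (simp add: depth_def transfer_0)
next
  case (Cons k a)
  have k: "k \<in> A" "set a \<subseteq> A" using Cons.prems by auto
  then have k1: "k \<ge> 1" using A_pos by auto
  have d: "depth (k # a) = k + depth a" by (simp add: depth_def)
  have IH: "(\<Prod>k\<leftarrow>a. th k) * (\<Sum>l\<in>UNIV. word_mat P a i l * app k f l) \<le> transfer (depth a) (app k f) i"
    using k Cons.prems by (intro Cons.IH app_nonneg) auto
  have "(\<Sum>j\<in>UNIV. word_mat P (k # a) i j * f j) = (\<Sum>j\<in>UNIV. \<Sum>l\<in>UNIV. word_mat P a i l * P k l j * f j)"
    by (simp add: mmul_def sum_distrib_right)
  also have "\<dots> = (\<Sum>l\<in>UNIV. \<Sum>j\<in>UNIV. word_mat P a i l * P k l j * f j)" by (rule sum.swap)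
  also have "\<dots> = (\<Sum>l\<in>UNIV. word_mat P a i l * app k f l)"
    by (simp add: app_def sum_distrib_left mult.assoc)
  finally have "(\<Prod>k\<leftarrow>k # a. th k) * (\<Sum>j\<in>UNIV. word_mat P (k # a) i j * f j)
      = th k * ((\<Prod>k\<leftarrow>a. th k) * (\<Sum>l\<in>UNIV. word_mat P a i l * app k f l))" by simp
  also have "\<dots> \<le> th k * transfer (depth a) (app k f) i"
    using IH th_nonneg by (rule mult_left_mono)
  also have "\<dots> = th k * transfer (depth (k # a) - k) (app k f) i" by (simp add: d)
  also have "\<dots> \<le> (\<Sum>k'\<in>A \<inter> {1..depth (k # a)}. th k' * transfer (depth (k # a) - k') (app k' f) i)"
  proof -
    have "k \<in> A \<inter> {1..depth (k # a)}" using k k1 d by simp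
    moreover have "0 \<le> th k' * transfer (depth (k # a) - k') (app k' f) i"
      if "k' \<in> A \<inter> {1..depth (k # a)} - {k}" for k'
      using that Cons.prems by (intro mult_nonneg_nonneg th_nonneg transfer_nonneg app_nonneg) auto
    ultimately show ?thesis by (intro member_le_sum) auto
  qed
  also have "\<dots> = transfer (depth (k # a)) f i" using k1 d by (simp add: transfer_rec)
  finally show ?case .
qed

text \<open>A Doeblin condition: each state has a word of depth \<open>L\<close> to \<open>j\<close>
  of positive weight, and the least of these finitely many weights serves for all states.\<close>

lemma transfer_minorization:
  assumes "\<And>i. \<exists>a. set a \<subseteq> A \<and> depth a = L \<and> word_mat P a i j > 0"
  shows "\<exists>\<epsilon>>0. \<forall>f i. (\<forall>i. f i \<ge> 0) \<longrightarrow> transfer L f i \<ge> \<epsilon> * f j"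
proof -
  obtain w where w: "\<And>i. set (w i) \<subseteq> A" "\<And>i. depth (w i) = L" "\<And>i. word_mat P (w i) i j > 0"
    using assms by metis
  define e where "e i = (\<Prod>k\<leftarrow>w i. th k) * word_mat P (w i) i j" for i
  have th_pos: "set a \<subseteq> A \<Longrightarrow> (\<Prod>k\<leftarrow>a. th k) > 0" for a
    by (induction a) (auto simp: th_def theta_pos)
  have e_pos: "e i > 0" for i unfolding e_def using w th_pos by simp
  define \<epsilon> where "\<epsilon> = Min (range e)"
  have \<epsilon>: "\<epsilon> > 0" "\<And>i. \<epsilon> \<le> e i" unfolding \<epsilon>_def using e_pos by auto
  have "transfer L f i \<ge> \<epsilon> * f j" if f: "\<forall>i. f i \<ge> 0" for f i
  proof -
    have "word_mat P (w i) i j * f j \<le> (\<Sum>j\<in>UNIV. word_mat P (w i) i j * f j)"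
      using f word_mat_nonneg[OF w(1)] by (intro member_le_sum) auto
    then have "e i * f j \<le> (\<Prod>k\<leftarrow>w i. th k) * (\<Sum>j\<in>UNIV. word_mat P (w i) i j * f j)"
      unfolding e_def using th_pos[OF w(1)[of i]] by (simp add: mult.assoc)
    also have "\<dots> \<le> transfer L f i" using transfer_ge_word[OF w(1)[of i], of f i] f w(2) by simp
    finally show ?thesis using \<epsilon>(2)[of i] f by (meson mult_right_mono order_trans)
  qed
  then show ?thesis using \<epsilon>(1) by blast
qed

text \<open>The minorization is applied to the nonnegative functions \<open>1 - f\<close> and
  \<open>1 + f\<close>. As \<open>\<epsilon> * f j\<close> does not involve \<open>i\<close>,
  \<open>transfer L f\<close> is a constant up to an error in which \<open>\<epsilon>\<close> has
  been gained.\<close>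

lemma transfer_contraction:
  assumes min: "\<forall>f i. (\<forall>i. f i \<ge> 0) \<longrightarrow> transfer L f i \<ge> \<epsilon> * f j" and f: "unit_fun f"
  shows "\<bar>transfer L f i - \<epsilon> * f j\<bar> \<le> renewal L - \<epsilon>"
proof -
  have f1: "\<And>i. f i \<le> 1" "\<And>i. - f i \<le> 1" using f unfolding unit_fun_def by (auto simp: abs_le_iff)
  have "transfer L (\<lambda>i. 1 - f i) i \<ge> \<epsilon> * (1 - f j)"
    using min[rule_format, of "\<lambda>i. 1 - f i" i] f1(1) by simp
  then have 1: "renewal L - transfer L f i \<ge> \<epsilon> - \<epsilon> * f j"
    unfolding transfer_diff transfer_one by (simp add: algebra_simps)
  \<comment> \<open>\<open>1 + f\<close> is written as a double difference so that
    \<open>transfer_diff\<close> evaluates it.\<close>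
  have neg: "transfer L (\<lambda>i. 1 - (0 - f i)) i = renewal L - (transfer L (\<lambda>_. 0) i - transfer L f i)"
    unfolding transfer_diff transfer_one ..
  have z: "transfer L (\<lambda>_. 0) i = 0"
    using transfer_diff[of L "\<lambda>_. 0" "\<lambda>_. 0" i] by simp
  have "transfer L (\<lambda>i. 1 - (0 - f i)) i \<ge> \<epsilon> * (1 - (0 - f j))"
  proof -
    have "0 \<le> 1 - (0 - f i)" for i using f1(2)[of i] by linarith
    then show ?thesis by (rule min[rule_format, of "\<lambda>i. 1 - (0 - f i)"])
  qed
  then have "renewal L + transfer L f i \<ge> \<epsilon> + \<epsilon> * f j" unfolding neg z by (simp add: algebra_simps)
  with 1 show ?thesis by (simp add: abs_le_iff)
qed

text \<open>Termination rests on the letters of \<open>A\<close> being positive; for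
  \<open>a\<close> outside \<open>A\<close> the guard makes the map the identity.\<close>

function move :: "int \<Rightarrow> nat \<Rightarrow> int \<times> ('g \<Rightarrow> real) \<Rightarrow> int \<times> ('g \<Rightarrow> real)" where
  "move c a (n, h) = (if n \<le> c \<or> a \<notin> A then (n, h) else move c a (n - int a, app a h))"
  by pat_completeness auto
termination
proof (relation "Wellfounded.measure (\<lambda>(c, a, n, h). nat (n - c))")
  fix c n :: int and a
  assume "\<not> (n \<le> c \<or> a \<notin> A)"
  moreover from this have "a > 0" using zero_notin_A by (metis gr0I)
  ultimately show "((c, a, n - int a, app a h), (c, a, n, h)) \<in> Wellfounded.measure (\<lambda>(c, a, n, h). nat (n - c))" for h
    by simp
qed simp

function move_weight :: "int \<Rightarrow> nat \<Rightarrow> int \<Rightarrow> real" where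
  "move_weight c a n = (if n \<le> c \<or> a \<notin> A then 1 else th a * move_weight c a (n - int a))"
  by pat_completeness auto
termination
proof (relation "Wellfounded.measure (\<lambda>(c, a, n). nat (n - c))")
  fix c n :: int and a
  assume "\<not> (n \<le> c \<or> a \<notin> A)"
  moreover from this have "a > 0" using zero_notin_A by (metis gr0I)
  ultimately show "((c, a, n - int a), (c, a, n)) \<in> Wellfounded.measure (\<lambda>(c, a, n). nat (n - c))"
    by simp
qed simp

declare move.simps [simp del] move_weight.simps [simp del]

lemma move_unit_fun: "unit_fun h \<Longrightarrow> unit_fun (snd (move c a (n, h)))"
proof (induction c a "(n, h)" arbitrary: n h rule: move.induct)
  case (1 c a n h)
  then show ?case by (subst move.simps) (auto intro: unit_fun_app)
qed

lemma unit_list_move: "unit_list l \<Longrightarrow> unit_list (map (move c a) l)"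
proof (induction l)
  case (Cons p l)
  obtain n h where p: "p = (n, h)" by force
  show ?case using Cons move_unit_fun[of h c a n] unfolding p
    by (cases "move c a (n, h)") simp
qed simp

text \<open>Each repetition lowers the site by at least 1, so at most \<open>nat (n - c)\<close>
  factors occur, each at least \<open>\<kappa>\<close>.\<close>

lemma move_weight_ge:
  assumes "0 < \<kappa>" "\<kappa> \<le> 1" "a \<in> A \<Longrightarrow> \<kappa> \<le> th a"
  shows "move_weight c a n \<ge> \<kappa> ^ nat (n - c)"
  using assms
proof (induction c a n rule: move_weight.induct)
  case (1 c a n)
  show ?case
  proof (cases "n \<le> c \<or> a \<notin> A")
    case True
    then show ?thesis using 1 by (subst move_weight.simps) (simp add: power_le_one)
  next
    case False
    then have a: "a > 0" using zero_notin_A by (metis gr0I)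
    have "\<kappa> ^ nat (n - c) \<le> \<kappa> ^ Suc (nat (n - int a - c))"
      using 1 False a by (intro power_decreasing) auto
    also have "\<dots> \<le> th a * move_weight c a (n - int a)"
      using 1 False th_nonneg by (auto intro!: mult_mono)
    finally show ?thesis using False by (subst move_weight.simps) simp
  qed
qed

text \<open>A letter in \<open>F\<close> has main term \<open>e k\<close> and retained weight
  \<open>v k\<close>; a letter outside \<open>F\<close> counts with weight 0. Since the
  \<open>th k\<close> sum to 1, main terms and weights are averaged alike and the shape of the
  estimate survives.\<close>

lemma averaging_bound:
  assumes F: "finite F" "F \<subseteq> A" and Y: "(\<lambda>k. th k * d k) sums Y"
    and d: "\<And>k. k \<in> A \<Longrightarrow> \<bar>d k\<bar> \<le> S"
    and e: "\<And>k. k \<in> F \<Longrightarrow> \<bar>d k - e k\<bar> \<le> (1 - v k) * S"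
  shows "\<bar>Y - (\<Sum>k\<in>F. th k * e k)\<bar> \<le> (1 - (\<Sum>k\<in>F. th k * v k)) * S"
proof -
  define z b where "z k = th k * d k - (if k \<in> F then th k * e k else 0)"
    and "b k = th k * S - (if k \<in> F then th k * v k * S else 0)" for k
  have z: "z sums (Y - (\<Sum>k\<in>F. th k * e k))"
    unfolding z_def using Y F(1) by (intro sums_diff sums_If_finite_set) auto
  have "b sums (1 * S - (\<Sum>k\<in>F. th k * v k * S))"
    unfolding b_def using F(1) by (intro sums_diff sums_If_finite_set sums_mult2 th_sums) auto
  then have b: "b sums ((1 - (\<Sum>k\<in>F. th k * v k)) * S)"
    by (simp add: sum_distrib_right left_diff_distrib)
  have zb: "\<bar>z k\<bar> \<le> b k" for k
  proof (cases "k \<in> F")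
    case True
    then have "\<bar>z k\<bar> = th k * \<bar>d k - e k\<bar>"
      unfolding z_def using th_nonneg[of k] by (simp add: right_diff_distrib[symmetric] abs_mult)
    also have "\<dots> \<le> th k * ((1 - v k) * S)" using e True th_nonneg by (intro mult_left_mono)
    finally show ?thesis unfolding b_def using True by (simp add: algebra_simps)
  next
    case False
    then show ?thesis using d[of k] th_nonneg[of k]
      by (cases "k \<in> A") (simp_all add: z_def b_def abs_mult mult_left_mono th_def)
  qed
  have "Y - (\<Sum>k\<in>F. th k * e k) \<le> (1 - (\<Sum>k\<in>F. th k * v k)) * S"
    by (rule sums_le[OF _ z b]) (use zb abs_le_iff in blast)
  moreover have "- (Y - (\<Sum>k\<in>F. th k * e k)) \<le> (1 - (\<Sum>k\<in>F. th k * v k)) * S"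
    by (rule sums_le[OF _ sums_minus[OF z] b]) (use zb abs_le_iff in blast)
  ultimately show ?thesis by (simp add: abs_le_iff)
qed

end

text \<open>The properties shared by all differences \<open>l \<mapsto> E\<^sub>\<mu> (ev l) - E\<^sub>\<nu> (ev l)\<close>
  of expectations under compatible laws.\<close>
locale imitation_functional = imitation A \<theta> P
  for A \<theta> and P :: "nat \<Rightarrow> 'g::finite \<Rightarrow> 'g \<Rightarrow> real" +
  fixes D :: "(int \<times> ('g \<Rightarrow> real)) list \<Rightarrow> real"
  assumes D_mset: "mset l = mset l' \<Longrightarrow> D l = D l'"
    and D_bounded: "unit_list l \<Longrightarrow> \<bar>D l\<bar> \<le> 2"
    and D_Nil: "D [] = 0"
    and D_tie: "D ((n, f) # (n, h) # l) = D ((n, \<lambda>i. f i * h i) # l)"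
    and D_add: "D ((n, \<lambda>i. f i + h i) # l) = D ((n, f) # l) + D ((n, h) # l)"
    and D_scale: "D ((n, \<lambda>i. c * f i) # l) = c * D ((n, f) # l)"
    and D_one: "D ((n, \<lambda>_. 1) # l) = D l"
    and D_step: "\<forall>(m, h)\<in>set l. m < n \<Longrightarrow>
      (\<lambda>k. th k * D ((n - int k, app k f) # l)) sums D ((n, f) # l)"
begin

lemma D_sum: "finite I \<Longrightarrow> D ((n, \<lambda>i. \<Sum>k\<in>I. c k * h k i) # l) = (\<Sum>k\<in>I. c k * D ((n, h k) # l))"
proof (induction I rule: finite_induct)
  case empty
  show ?case using D_scale[of n 0 "\<lambda>_. 1" l] by simp
next
  case (insert x I)
  then show ?case
    using D_add[of n "\<lambda>i. c x * h x i" "\<lambda>i. \<Sum>k\<in>I. c k * h k i" l] D_scale[of n "c x" "h x" l] by simp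
qed

lemma D_scaled_bound:
  assumes bd: "\<And>f. unit_fun f \<Longrightarrow> \<bar>D ((n, f) # l)\<bar> \<le> S" and f: "\<And>i. \<bar>f i\<bar> \<le> b"
  shows "\<bar>D ((n, f) # l)\<bar> \<le> b * S"
proof (cases "b = 0")
  case True
  then have "f = (\<lambda>i. 0 * 1)" using f by auto
  then have "D ((n, f) # l) = 0" using D_scale[of n 0 "\<lambda>_. 1" l] by simp
  then show ?thesis using True by simp
next
  case False
  have b: "b > 0" using False f[of undefined] by linarith
  have "unit_fun (\<lambda>i. f i / b)" unfolding unit_fun_def using f b by simp
  moreover have "D ((n, f) # l) = b * D ((n, \<lambda>i. f i / b) # l)"
    using D_scale[of n b "\<lambda>i. f i / b" l] b by simp
  ultimately show ?thesis using bd b by (simp add: abs_mult)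
qed

section \<open>Contraction for \<open>r + 1\<close> factors when \<open>D\<close> vanishes on
  \<open>r\<close> factors\<close>

context
  fixes r a K :: nat and S \<kappa> :: real
  assumes shorter: "\<And>l. length l = r \<Longrightarrow> unit_list l \<Longrightarrow> D l = 0"
    and bound: "\<And>l. length l = Suc r \<Longrightarrow> unit_list l \<Longrightarrow> \<bar>D l\<bar> \<le> S"
    and S: "S \<ge> 0" and a: "a \<in> A" "a \<le> K"
    and \<kappa>: "\<kappa> > 0" "\<kappa> \<le> 1" "\<And>k. k \<in> A \<Longrightarrow> k \<le> K \<Longrightarrow> \<kappa> \<le> th k"
begin

text \<open>Two factors at one site multiply to a single unit function, which leaves
  \<open>r\<close> factors.\<close>

lemma tie_zero:
  assumes "mset l = mset ((n, f) # (n, h) # l')" "length l = Suc r" "unit_list l"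
  shows "D l = 0"
proof -
  have len: "length l = Suc (Suc (length l'))" using mset_eq_length[OF assms(1)] by simp
  have "set l = set ((n, f) # (n, h) # l')" using assms(1) by (rule mset_eq_setD)
  then have u: "unit_fun f" "unit_fun h" "unit_list l'"
    using assms(3) unfolding unit_list_def by auto
  have "unit_fun (\<lambda>i. f i * h i)"
    using u unfolding unit_fun_def abs_mult by (metis abs_ge_zero mult_le_one)
  then have "D ((n, \<lambda>i. f i * h i) # l') = 0"
    using u len assms(2) by (intro shorter) auto
  then show ?thesis using D_mset[OF assms(1)] D_tie by simp
qed

text \<open>Following the single letter \<open>k\<close> costs a factor
  \<open>th k \<ge> \<kappa>\<close>, which the drop from \<open>N\<close> to \<open>N'\<close> pays
  for; all other letters are estimated by \<open>S\<close>.\<close>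

lemma decay:
  assumes Y: "(\<lambda>k. th k * d k) sums Y" and d: "\<And>k. k \<in> A \<Longrightarrow> \<bar>d k\<bar> \<le> S"
    and k: "k \<in> A" "k \<le> K" "\<bar>d k\<bar> \<le> (1 - \<kappa> ^ N') * S" and N: "N' < N"
  shows "\<bar>Y\<bar> \<le> (1 - \<kappa> ^ N) * S"
proof -
  have "\<bar>Y - (\<Sum>k\<in>{k}. th k * 0)\<bar> \<le> (1 - (\<Sum>k\<in>{k}. th k * \<kappa> ^ N')) * S"
    using k by (intro averaging_bound[OF _ _ Y d]) auto
  moreover have "\<kappa> ^ N \<le> th k * \<kappa> ^ N'"
  proof -
    have "\<kappa> ^ N \<le> \<kappa> ^ Suc N'" using N \<kappa> by (intro power_decreasing) auto
    also have "\<dots> \<le> th k * \<kappa> ^ N'" using \<kappa> k by (simp add: mult_right_mono)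
    finally show ?thesis .
  qed
  then have "(1 - th k * \<kappa> ^ N') * S \<le> (1 - \<kappa> ^ N) * S" using S by (intro mult_right_mono) auto
  ultimately show ?thesis by simp
qed

text \<open>All particles of \<open>os\<close> are moved below level \<open>c\<close> along the fixed letter \<open>a\<close>, while the first
  particle explores all words leading exactly to \<open>c\<close>. Whenever two particles meet on the way, the
  functional vanishes at that configuration; this is the first alternative.\<close>
lemma contraction_alternatives:
  assumes "s \<le> K" "length os = r" "unit_fun f" "unit_list os"
    and "N = s + (\<Sum>(n, h)\<leftarrow>os. nat (n - c))"
  shows "\<bar>D ((c + int s, f) # os)\<bar> \<le> (1 - \<kappa> ^ N) * S \<or>
    \<bar>D ((c + int s, f) # os) -
      (\<Prod>(n, h)\<leftarrow>os. move_weight c a n) * D ((c, transfer s f) # map (move c a) os)\<bar>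
      \<le> (1 - (\<Prod>(n, h)\<leftarrow>os. move_weight c a n) * renewal s) * S"
  using assms
\<comment> \<open>\<open>N\<close> adds up the distances above \<open>c\<close> still to be covered,
  by the first factor and by all others; every move lowers it, so it serves both as induction
  measure and as exponent.\<close>
proof (induction N arbitrary: s f os rule: less_induct)
  case (less N)
  define W where "W os = (\<Prod>(n, h)\<leftarrow>os. move_weight c a n)" for os :: "(int \<times> ('g \<Rightarrow> real)) list"
  let ?os = "map (move c a) os"
  note prems = less.prems
  \<comment> \<open>Only a strictly highest site can be conditioned on its past. The first factor
    moves when it is highest; otherwise the highest of the others does.\<close>
  consider (stop) "s = 0" "\<forall>(n, h)\<in>set os. n \<le> c"
    | (first) "s > 0" "\<forall>(n, h)\<in>set os. n < c + int s"
    | (other) "\<exists>(n, h)\<in>set os. n \<ge> c + int s \<and> n > c"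
    by (cases "s = 0"; fastforce)
  then show ?case
  proof cases
    case stop
    have "?os = os \<and> W os = 1" using stop(2)
      by (induction os) (auto simp: W_def move.simps move_weight.simps)
    then show ?thesis using stop(1) by (simp add: W_def transfer_0 renewal.simps)
  next
    case first
    \<comment> \<open>Letters beyond \<open>s\<close> would jump past \<open>c\<close>; they stay
      outside \<open>F\<close> and are charged the full bound \<open>S\<close>.\<close>
    define F where "F = A \<inter> {1..s}"
    define d where "d k = D ((c + int s - int k, app k f) # os)" for k
    have Y: "(\<lambda>k. th k * d k) sums D ((c + int s, f) # os)"
      unfolding d_def using first(2) by (rule D_step)
    have dS: "\<bar>d k\<bar> \<le> S" if "k \<in> A" for k
      unfolding d_def using that prems by (intro bound) (auto intro: unit_fun_app)
    have IH: "\<bar>d k\<bar> \<le> (1 - \<kappa> ^ (N - k)) * S \<or>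
        \<bar>d k - W os * D ((c, transfer (s - k) (app k f)) # ?os)\<bar> \<le> (1 - W os * renewal (s - k)) * S"
      if k: "k \<in> F" for k
    proof -
      have "c + int s - int k = c + int (s - k)" using k by (simp add: F_def of_nat_diff)
      moreover have "N - k < N" using k prems(5) first(1) by (auto simp: F_def)
      ultimately show ?thesis
        unfolding d_def W_def using k prems
        by (simp only:) (intro less.IH; auto simp: F_def intro: unit_fun_app)
    qed
    show ?thesis
    \<comment> \<open>One letter with the first alternative already yields it for the whole average.
      Otherwise all letters of \<open>F\<close> have the second one, and their main terms add up by
      the recursions of \<open>transfer\<close> and \<open>renewal\<close>.\<close>
    proof (cases "\<exists>k\<in>F. \<bar>d k\<bar> \<le> (1 - \<kappa> ^ (N - k)) * S")
      case True
      then obtain k where k: "k \<in> F" "\<bar>d k\<bar> \<le> (1 - \<kappa> ^ (N - k)) * S" by blast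
      have "N - k < N" "k \<in> A" "k \<le> K" using k prems first(1) by (auto simp: F_def)
      then show ?thesis using decay[OF Y dS _ _ k(2)] by blast
    next
      case False
      have fin: "finite F" "F \<subseteq> A" by (auto simp: F_def)
      have "\<bar>D ((c + int s, f) # os) - (\<Sum>k\<in>F. th k * (W os * D ((c, transfer (s - k) (app k f)) # ?os)))\<bar>
          \<le> (1 - (\<Sum>k\<in>F. th k * (W os * renewal (s - k)))) * S"
        using False IH by (intro averaging_bound[OF fin Y dS]) auto
      moreover have "(\<Sum>k\<in>F. th k * (W os * renewal (s - k))) = W os * renewal s"
        using first(1) by (simp add: renewal.simps[of s] F_def sum_distrib_left mult.left_commute)
      moreover have "(\<Sum>k\<in>F. th k * (W os * D ((c, transfer (s - k) (app k f)) # ?os)))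
          = W os * D ((c, transfer s f) # ?os)"
        unfolding transfer_rec[OF first(1)] F_def[symmetric] D_sum[OF fin(1)]
        by (simp add: sum_distrib_left mult.left_commute)
      ultimately show ?thesis unfolding W_def by simp
    qed
  next
    case other
    then have ne: "set os \<noteq> {}" by auto
    define n where "n = Max (fst ` set os)"
    have "n \<in> fst ` set os" unfolding n_def using ne by (intro Max_in) auto
    then obtain h where h: "(n, h) \<in> set os" by force
    have n_max: "m \<le> n" if "(m, h') \<in> set os" for m h'
      unfolding n_def using that by (intro Max_ge) force+
    have n: "n \<ge> c + int s" "n > c" using other n_max by fastforce+
    obtain o1 o2 where os: "os = o1 @ (n, h) # o2" using split_list[OF h] by blast
    define rest where "rest = (c + int s, f) # o1 @ o2"
    have ms: "mset ((c + int s, f) # os) = mset ((n, h) # rest)"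
      unfolding os rest_def by simp
    have len: "length ((c + int s, f) # os) = Suc r" "unit_list ((c + int s, f) # os)"
      using prems by auto
    show ?thesis
    \<comment> \<open>A second factor at \<open>n\<close>, possibly the first one of the list, is a
      meeting and makes \<open>D\<close> vanish; otherwise \<open>n\<close> is strictly
      highest.\<close>
    proof (cases "\<exists>h'. (n, h') \<in> set rest")
      case True
      then obtain h' r1 r2 where "rest = r1 @ (n, h') # r2" by (meson split_list)
      then have "mset ((c + int s, f) # os) = mset ((n, h) # (n, h') # r1 @ r2)" using ms by simp
      then have "D ((c + int s, f) # os) = 0" using len by (rule tie_zero)
      moreover have "\<kappa> ^ N \<le> 1" using \<kappa> by (simp add: power_le_one)
      ultimately show ?thesis using S by simp
    next
      case False
      have below: "\<forall>(m, h')\<in>set rest. m < n"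
      proof safe
        fix m h' assume m: "(m, h') \<in> set rest"
        then have "m \<le> n" using n(1) n_max unfolding rest_def os by auto
        moreover have "m \<noteq> n" using m False by blast
        ultimately show "m < n" by simp
      qed
      \<comment> \<open>Of the expansion at \<open>n\<close> only the letter \<open>a\<close> is
        followed; all others are charged \<open>S\<close>.\<close>
      define os' where "os' = o1 @ (n - int a, app a h) # o2"
      define d where "d k = D ((n - int k, app k h) # rest)" for k
      have "(\<lambda>k. th k * d k) sums D ((n, h) # rest)"
        unfolding d_def using below by (rule D_step)
      then have Y: "(\<lambda>k. th k * d k) sums D ((c + int s, f) # os)" using D_mset[OF ms] by simp
      have u: "unit_fun h" "unit_list o1" "unit_list o2" using prems(4) os by auto
      have dS: "\<bar>d k\<bar> \<le> S" if "k \<in> A" for k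
        unfolding d_def rest_def using that prems u os by (intro bound) (auto intro: unit_fun_app)
      have da: "d a = D ((c + int s, f) # os')"
        unfolding d_def os'_def rest_def by (rule D_mset) simp
      define N' where "N' = s + (\<Sum>(n, h)\<leftarrow>os'. nat (n - c))"
      have a0: "a > 0" using a(1) zero_notin_A by (metis gr0I)
      have "nat (n - int a - c) < nat (n - c)" using n(2) a0 by simp
      then have N': "N' < N" unfolding N'_def prems(5) os os'_def by simp
      have W: "W os = th a * W os'"
        unfolding W_def os os'_def using n(2) a(1) by (simp add: move_weight.simps[of c a n])
      have mv: "map (move c a) os = map (move c a) os'"
        unfolding os os'_def using n(2) a(1) by (simp add: move.simps[of c a n])
      have "\<bar>d a\<bar> \<le> (1 - \<kappa> ^ N') * S \<or>
        \<bar>d a - W os' * D ((c, transfer s f) # map (move c a) os')\<bar> \<le> (1 - W os' * renewal s) * S"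
        unfolding da W_def
      proof (rule less.IH[OF N' prems(1) _ prems(3)])
        show "length os' = r" using prems(2) unfolding os os'_def by simp
        show "unit_list os'" unfolding os'_def using u a by (auto intro: unit_fun_app)
      qed (rule N'_def)
      then show ?thesis
      proof
        assume "\<bar>d a\<bar> \<le> (1 - \<kappa> ^ N') * S"
        then show ?thesis using decay[OF Y dS a _ N'] by blast
      next
        assume e: "\<bar>d a - W os' * D ((c, transfer s f) # map (move c a) os')\<bar> \<le> (1 - W os' * renewal s) * S"
        have "\<bar>D ((c + int s, f) # os) - (\<Sum>k\<in>{a}. th k * (W os' * D ((c, transfer s f) # map (move c a) os')))\<bar>
          \<le> (1 - (\<Sum>k\<in>{a}. th k * (W os' * renewal s))) * S"
          using a e by (intro averaging_bound[OF _ _ Y dS]) auto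
        then show ?thesis unfolding mv W_def[symmetric] W by (simp add: mult.assoc)
      qed
    qed
  qed
qed

text \<open>The gain does not depend on the sites in \<open>l\<close>. The factor
  \<open>min 1 \<epsilon>\<close> covers both alternatives: the first gains a power of
  \<open>\<kappa>\<close>, the second at least such a power times \<open>\<epsilon>\<close>.\<close>

lemma contraction:
  assumes L: "L \<le> K" and \<epsilon>: "\<epsilon> > 0"
    and min: "\<forall>f i. (\<forall>i. f i \<ge> 0) \<longrightarrow> transfer L f i \<ge> \<epsilon> * f j"
    and l: "length l = Suc r" "unit_list l"
  shows "\<bar>D l\<bar> \<le> (1 - \<kappa> ^ (L + r * L) * min 1 \<epsilon>) * S"
proof -
  define n where "n = Max (fst ` set l)"
  have "set l \<noteq> {}" using l(1) by auto
  then have "n \<in> fst ` set l" unfolding n_def by (intro Max_in) auto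
  then obtain f where "(n, f) \<in> set l" by force
  then obtain l1 l2 where l12: "l = l1 @ (n, f) # l2" by (meson split_list)
  \<comment> \<open>With the highest site as first factor and \<open>c\<close> exactly
    \<open>L\<close> below it, every other site is at most \<open>L\<close> above \<open>c\<close>;
    this bounds \<open>N\<close> whatever the gaps.\<close>
  define os c where "os = l1 @ l2" and "c = n - int L"
  have n_max: "m \<le> n" if "(m, h) \<in> set os" for m h
    unfolding n_def using that by (intro Max_ge) (force simp: l12 os_def)+
  have Dl: "D l = D ((c + int L, f) # os)" unfolding l12 os_def c_def by (rule D_mset) simp
  have u: "unit_fun f" "unit_list os" "length os = r" using l unfolding l12 os_def by auto
  define W where "W = (\<Prod>(n, h)\<leftarrow>os. move_weight c a n)"
  define N where "N = L + (\<Sum>(n, h)\<leftarrow>os. nat (n - c))"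
  define \<delta> where "\<delta> = \<kappa> ^ (L + r * L)"
  have "(\<Sum>(n, h)\<leftarrow>os. nat (n - c)) \<le> (\<Sum>(n, h)\<leftarrow>os. L)"
    using n_max by (intro sum_list_mono) (fastforce simp: c_def nat_le_iff)
  moreover have "(\<Sum>(n, h)\<leftarrow>os'. L) = length os' * L" for os' :: "(int \<times> ('g \<Rightarrow> real)) list"
    by (induction os') auto
  ultimately have NL: "N \<le> L + r * L" unfolding N_def using u(3) by simp
  have \<delta>N: "\<delta> \<le> \<kappa> ^ N" unfolding \<delta>_def using NL \<kappa> by (intro power_decreasing) auto
  have "(\<Prod>(n, h)\<leftarrow>os'. move_weight c a n) \<ge> \<kappa> ^ (\<Sum>(n, h)\<leftarrow>os'. nat (n - c))" for os' :: "(int \<times> ('g \<Rightarrow> real)) list"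
  proof (induction os')
    case (Cons p os')
    obtain m h where p: "p = (m, h)" by force
    have w: "\<kappa> ^ nat (m - c) \<le> move_weight c a m"
      using \<kappa> a by (intro move_weight_ge) auto
    have "0 \<le> \<kappa> ^ nat (m - c)" "0 \<le> \<kappa> ^ (\<Sum>(n, h)\<leftarrow>os'. nat (n - c))" using \<kappa>(1) by simp_all
    then have "\<kappa> ^ nat (m - c) * \<kappa> ^ (\<Sum>(n, h)\<leftarrow>os'. nat (n - c))
        \<le> move_weight c a m * (\<Prod>(n, h)\<leftarrow>os'. move_weight c a n)"
      using w Cons.IH by (intro mult_mono) linarith+
    then show ?case by (simp add: p power_add)
  qed simp
  then have "\<kappa> ^ (\<Sum>(n, h)\<leftarrow>os. nat (n - c)) \<le> W" unfolding W_def .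
  moreover have "\<kappa> ^ N \<le> \<kappa> ^ (\<Sum>(n, h)\<leftarrow>os. nat (n - c))"
    unfolding N_def using \<kappa> by (intro power_decreasing) auto
  ultimately have W: "\<delta> \<le> W" using \<delta>N by linarith
  have \<delta>0: "\<delta> > 0" unfolding \<delta>_def using \<kappa> by simp
  have "\<bar>D l\<bar> \<le> (1 - \<kappa> ^ N) * S \<or>
    \<bar>D l - W * D ((c, transfer L f) # map (move c a) os)\<bar> \<le> (1 - W * renewal L) * S"
    unfolding Dl W_def using u L by (intro contraction_alternatives) (simp_all add: N_def)
  then show ?thesis
  proof
    assume "\<bar>D l\<bar> \<le> (1 - \<kappa> ^ N) * S"
    moreover have "\<delta> * min 1 \<epsilon> \<le> \<delta> * 1" using \<delta>0 by (intro mult_left_mono) auto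
    then have "(1 - \<kappa> ^ N) * S \<le> (1 - \<delta> * min 1 \<epsilon>) * S"
      using S \<delta>N by (intro mult_right_mono) linarith+
    ultimately show ?thesis unfolding \<delta>_def by linarith
  next
    assume alt: "\<bar>D l - W * D ((c, transfer L f) # map (move c a) os)\<bar> \<le> (1 - W * renewal L) * S"
    let ?os = "map (move c a) os"
    \<comment> \<open>\<open>transfer L f\<close> splits into the constant
      \<open>\<epsilon> * f j\<close> and a remainder of size at most
      \<open>renewal L - \<epsilon>\<close>. The constant drops out, since it leaves only the
      \<open>r\<close> factors of \<open>?os\<close>.\<close>
    define g where "g i = transfer L f i - \<epsilon> * f j" for i
    have uos: "unit_list ?os" "length ?os = r" using u unit_list_move by auto
    have "D ((c, transfer L f) # ?os) = D ((c, \<lambda>i. g i + \<epsilon> * f j * 1) # ?os)" by (simp add: g_def)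
    also have "\<dots> = D ((c, g) # ?os) + \<epsilon> * f j * D ?os"
      unfolding D_add using D_scale[of c "\<epsilon> * f j" "\<lambda>_. 1" ?os] D_one[of c ?os] by simp
    also have "D ?os = 0" using uos by (intro shorter) auto
    finally have "D ((c, transfer L f) # ?os) = D ((c, g) # ?os)" by simp
    moreover have "\<bar>D ((c, g) # ?os)\<bar> \<le> (renewal L - \<epsilon>) * S"
    proof (rule D_scaled_bound)
      show "\<bar>g i\<bar> \<le> renewal L - \<epsilon>" for i
        unfolding g_def using min u(1) by (rule transfer_contraction)
      show "\<bar>D ((c, f) # ?os)\<bar> \<le> S" if "unit_fun f" for f
        using that uos by (intro bound) auto
    qed
    ultimately have "\<bar>W * D ((c, transfer L f) # ?os)\<bar> \<le> W * ((renewal L - \<epsilon>) * S)"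
      using W \<delta>0 by (simp add: abs_mult mult_left_mono)
    then have "\<bar>D l\<bar> \<le> W * ((renewal L - \<epsilon>) * S) + (1 - W * renewal L) * S" using alt by linarith
    \<comment> \<open>The terms with \<open>renewal L\<close> cancel: the gain
      \<open>W * \<epsilon>\<close> comes from the minorization.\<close>
    also have "\<dots> = (1 - W * \<epsilon>) * S" by (simp add: algebra_simps)
    also have "\<dots> \<le> (1 - \<delta> * min 1 \<epsilon>) * S"
      using S W \<delta>0 \<epsilon> by (intro mult_right_mono diff_left_mono mult_mono) auto
    finally show ?thesis unfolding \<delta>_def .
  qed
qed

end

lemma D_zero:
  assumes words: "\<And>i. \<exists>a. set a \<subseteq> A \<and> depth a = L \<and> word_mat P a i j > 0"
    and "unit_list l"
  shows "D l = 0"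
  using assms(2)
proof (induction "length l" arbitrary: l)
  case 0
  then show ?case using D_Nil by simp
next
  case (Suc r)
  obtain \<epsilon> where \<epsilon>: "\<epsilon> > 0" "\<forall>f i. (\<forall>i. f i \<ge> 0) \<longrightarrow> transfer L f i \<ge> \<epsilon> * f j"
    using transfer_minorization[OF words] by blast
  obtain a where a: "a \<in> A" using A_nonempty by blast
  \<comment> \<open>\<open>K\<close> bounds all letters that are followed: \<open>a\<close>, and the
    letters up to \<open>L\<close> by which the first factor approaches \<open>c\<close>. Hence
    \<open>\<kappa>\<close> below is a minimum over a finite set; inserting 1 gives
    \<open>\<kappa> \<le> 1\<close>.\<close>
  define K where "K = max a L"
  define \<kappa> where "\<kappa> = Min (insert 1 (th ` (A \<inter> {..K})))"
  have "th k > 0" if "k \<in> A" for k using that theta_pos by (simp add: th_def)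
  then have \<kappa>: "\<kappa> > 0" "\<kappa> \<le> 1" "\<And>k. k \<in> A \<Longrightarrow> k \<le> K \<Longrightarrow> \<kappa> \<le> th k"
    unfolding \<kappa>_def by auto
  define U where "U = {l :: (int \<times> ('g \<Rightarrow> real)) list. length l = Suc r \<and> unit_list l}"
  define S where "S = (SUP l\<in>U. \<bar>D l\<bar>)"
  have bdd: "bdd_above ((\<lambda>l. \<bar>D l\<bar>) ` U)"
    using D_bounded unfolding U_def by (intro bdd_aboveI[of _ 2]) auto
  have SU: "\<bar>D l\<bar> \<le> S" if "l \<in> U" for l unfolding S_def using that bdd by (rule cSUP_upper)
  have lU: "l \<in> U" using Suc unfolding U_def by simp
  have S0: "S \<ge> 0" using SU[OF lU] by linarith
  have L: "L \<le> K" "a \<le> K" unfolding K_def by auto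
  have "\<bar>D l\<bar> \<le> (1 - \<kappa> ^ (L + r * L) * min 1 \<epsilon>) * S" if "l \<in> U" for l
    by (rule contraction[OF _ _ S0 a L(2) \<kappa> L(1) \<epsilon>]) (use that SU Suc.hyps(1) in \<open>auto simp: U_def\<close>)
  then have "S \<le> (1 - \<kappa> ^ (L + r * L) * min 1 \<epsilon>) * S"
    unfolding S_def using lU by (intro cSUP_least) auto
  then have "\<kappa> ^ (L + r * L) * min 1 \<epsilon> * S \<le> 0" by (simp add: algebra_simps)
  moreover have "\<kappa> ^ (L + r * L) * min 1 \<epsilon> > 0" using \<kappa> \<epsilon> by simp
  ultimately have "S \<le> 0" by (metis mult_pos_pos not_le)
  then show "D l = 0" using SU[OF lU] by linarith
qed

end

section \<open>Uniqueness of compatible laws\<close>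

lemma cyl_Cons: "x \<in> cyl ((n, g) # l) \<longleftrightarrow> x n = g \<and> x \<in> cyl l"
  by (simp add: cyl_def)

context imitation
begin

lemma compatible_imitation_law: "compatible kernel M \<Longrightarrow> imitation_law A \<theta> P M"
  unfolding imitation_law_def path_law_def path_law_axioms_def compatible_def
  using imitation_axioms by blast

text \<open>The difference of expectations inherits the axioms of
  \<open>imitation_functional\<close> from linearity and the one-step identity. Cylinder indicators
  are products of unit functions, so its vanishing equates the laws.\<close>

lemma compatible_unique:
  assumes R: "R \<in> classes A P" "closed_class A P R" "j \<in> R"
    and ess: "essentially_irreducible A P" and ap: "Gcd (return_depths j) = Gcd A"
    and M: "compatible kernel M" and N: "compatible kernel N"
  shows "M = N"
proof -
  interpret M: imitation_law A \<theta> P M using M by (rule compatible_imitation_law)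
  interpret N: imitation_law A \<theta> P N using N by (rule compatible_imitation_law)
  define D where "D l = (\<integral>x. ev l x \<partial>M) - (\<integral>x. ev l x \<partial>N)" for l
  have le1: "\<bar>ev l x\<bar> \<le> 1" if "unit_list l" for l and x :: "int \<Rightarrow> 'g"
    using that
  proof (induction l)
    case (Cons p l)
    then show ?case
      by (cases p) (auto simp: unit_fun_def abs_mult intro: mult_le_one)
  qed simp
  interpret imitation_functional A \<theta> P D
  proof
    fix l l' :: "(int \<times> ('g \<Rightarrow> real)) list" and n f h and c :: real
    show "D l = D l'" if "mset l = mset l'" using ev_cong_mset[OF that] by (simp add: D_def)
    show "\<bar>D l\<bar> \<le> 2" if l: "unit_list l"
    proof -
      have "\<bar>\<integral>x. ev l x \<partial>M\<bar> \<le> (\<integral>x. \<bar>ev l x\<bar> \<partial>M)" "\<bar>\<integral>x. ev l x \<partial>N\<bar> \<le> (\<integral>x. \<bar>ev l x\<bar> \<partial>N)"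
        by (rule integral_abs_bound)+
      moreover have "(\<integral>x. \<bar>ev l x\<bar> \<partial>M) \<le> 1" "(\<integral>x. \<bar>ev l x\<bar> \<partial>N) \<le> 1"
        using le1[OF l] M.integrable_ev N.integrable_ev
        by (auto intro!: M.integral_le_const N.integral_le_const)
      ultimately show ?thesis unfolding D_def by linarith
    qed
    show "D [] = 0" by (simp add: D_def M.prob_space N.prob_space)
    show "D ((n, f) # (n, h) # l) = D ((n, \<lambda>i. f i * h i) # l)"
      by (simp add: D_def mult.assoc)
    show "D ((n, \<lambda>i. f i + h i) # l) = D ((n, f) # l) + D ((n, h) # l)"
    proof -
      have e: "ev ((n, \<lambda>i. f i + h i) # l) = (\<lambda>x. ev ((n, f) # l) x + ev ((n, h) # l) x)"
        by (rule ext) (simp add: distrib_right)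
      show ?thesis unfolding D_def e
        by (simp only: Bochner_Integration.integral_add[OF M.integrable_ev M.integrable_ev]
            Bochner_Integration.integral_add[OF N.integrable_ev N.integrable_ev] add_diff_add)
    qed
    show "D ((n, \<lambda>i. c * f i) # l) = c * D ((n, f) # l)"
      by (simp add: D_def mult.assoc right_diff_distrib)
    show "D ((n, \<lambda>_. 1) # l) = D l" by (simp add: D_def)
    show "(\<lambda>k. th k * D ((n - int k, app k f) # l)) sums D ((n, f) # l)"
      if "\<forall>(m, h)\<in>set l. m < n"
      using sums_diff[OF M.compatible_integral_sums[OF M that] N.compatible_integral_sums[OF N that]]
      by (simp add: D_def right_diff_distrib)
  qed
  obtain L where L: "\<And>i. \<exists>a. set a \<subseteq> A \<and> depth a = L \<and> word_mat P a i j > 0"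
    using uniform_depth[OF R ess ap] by blast
  show ?thesis
  proof (rule law_eqI)
    fix l :: "(int \<times> 'g) list"
    define el where "el = map (\<lambda>(n, g). (n :: int, \<lambda>h :: 'g. of_bool (h = g) :: real)) l"
    have el: "ev el = indicator (cyl l)" unfolding el_def using ev_indicators by blast
    have "unit_list el" by (auto simp: el_def unit_list_def unit_fun_def)
    then have "D el = 0" using L by (intro D_zero)
    then show "measure M (cyl l) = measure N (cyl l)" by (simp add: D_def el)
  qed (use M N in \<open>simp_all add: compatible_def\<close>)
qed

section \<open>Existence of compatible laws\<close>

text \<open>The expectation for the process that starts from the frozen configuration \<open>x0\<close>
  and resamples the sites \<open>t, \<dots>, t + m - 1\<close> one after the other.\<close>
primrec expect :: "(int \<Rightarrow> 'g) \<Rightarrow> int \<Rightarrow> nat \<Rightarrow> ((int \<Rightarrow> 'g) \<Rightarrow> real) \<Rightarrow> real" where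
  "expect x0 t 0 \<phi> = \<phi> x0"
| "expect x0 t (Suc m) \<phi> = expect x0 t m
    (\<lambda>x. \<Sum>g\<in>UNIV. kernel g (\<lambda>k. x (t + int m - int k)) * \<phi> (x(t + int m := g)))"

lemma expect_mono: "(\<And>x. \<phi> x \<le> \<psi> x) \<Longrightarrow> expect x0 t m \<phi> \<le> expect x0 t m \<psi>"
proof (induction m arbitrary: \<phi> \<psi>)
  case (Suc m)
  show ?case unfolding expect.simps
    by (intro Suc.IH sum_mono mult_left_mono Suc.prems kernel_nonneg)
qed simp

lemma expect_add: "expect x0 t m (\<lambda>x. \<phi> x + \<psi> x) = expect x0 t m \<phi> + expect x0 t m \<psi>"
  by (induction m arbitrary: \<phi> \<psi>) (simp_all add: distrib_left sum.distrib)

lemma expect_scale: "expect x0 t m (\<lambda>x. c * \<phi> x) = c * expect x0 t m \<phi>"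
proof (induction m arbitrary: \<phi>)
  case (Suc m)
  have "(\<lambda>x. \<Sum>g\<in>UNIV. kernel g (\<lambda>k. x (t + int m - int k)) * (c * \<phi> (x(t + int m := g))))
    = (\<lambda>x. c * (\<Sum>g\<in>UNIV. kernel g (\<lambda>k. x (t + int m - int k)) * \<phi> (x(t + int m := g))))"
    by (simp add: sum_distrib_left mult.left_commute)
  then show ?case using Suc by simp
qed simp

lemma expect_sum:
  "finite I \<Longrightarrow> expect x0 t m (\<lambda>x. \<Sum>i\<in>I. \<phi> i x) = (\<Sum>i\<in>I. expect x0 t m (\<phi> i))"
proof (induction I rule: finite_induct)
  case empty
  show ?case using expect_scale[of x0 t m 0 "\<lambda>_. 0"] by simp
qed (simp add: expect_add)

text \<open>For fixed \<open>m\<close> the functional is a finite linear combination of evaluations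
  of its argument, so it commutes with pointwise convergent series without any domination.\<close>

lemma expect_sums:
  "(\<And>x. (\<lambda>k. \<phi> k x) sums \<Phi> x) \<Longrightarrow> (\<lambda>k. expect x0 t m (\<phi> k)) sums expect x0 t m \<Phi>"
proof (induction m arbitrary: \<phi> \<Phi>)
  case (Suc m)
  show ?case unfolding expect.simps
    by (intro Suc.IH sums_sum sums_mult Suc.prems)
qed simp

lemma expect_one: "expect x0 t m (\<lambda>_. 1) = 1"
  by (induction m) (simp_all add: kernel_sum)

lemma expect_indicator_bounds:
  "expect x0 t m (indicator X) \<ge> 0" "expect x0 t m (indicator X) \<le> 1"
proof -
  have "expect x0 t m (\<lambda>_. 0) = 0" using expect_scale[of x0 t m 0 "\<lambda>_. 0"] by simp
  then show "expect x0 t m (indicator X) \<ge> 0" by (metis expect_mono indicator_pos_le)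
  show "expect x0 t m (indicator X) \<le> 1" by (metis expect_mono expect_one indicator_le_1)
qed

lemma expect_later:
  assumes "m \<le> m'" "\<And>x n g. n \<ge> t + int m \<Longrightarrow> \<phi> (x(n := g)) = \<phi> x"
  shows "expect x0 t m' \<phi> = expect x0 t m \<phi>"
  using assms(1)
proof (induction m' rule: dec_induct)
  case (step m')
  have "\<phi> (x(t + int m' := g)) = \<phi> x" for x g using step by (intro assms(2)) simp
  then have "expect x0 t (Suc m') \<phi> = expect x0 t m' \<phi>"
    by (simp add: sum_distrib_right[symmetric] kernel_sum)
  then show ?case using step by simp
qed simp

text \<open>Letters are positive, so the kernel at \<open>s\<close> sees only sites below
  \<open>s\<close>.\<close>

lemma kernel_update:
  assumes "n \<ge> s"
  shows "kernel g (\<lambda>k. (x(n := h)) (s - int k)) = kernel g (\<lambda>k. x (s - int k))"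
  unfolding kernel_def imitation_kernel_def
proof (rule infsum_cong)
  fix k assume "k \<in> A"
  then have "k > 0" using zero_notin_A by (metis gr0I)
  then show "\<theta> k * P k ((x(n := h)) (s - int k)) g = \<theta> k * P k (x (s - int k)) g"
    using assms by simp
qed

lemma expect_cyl_sums:
  assumes s: "t \<le> s" "s < t + int m" and l: "\<forall>(n, h)\<in>set l. n < s"
  shows "(\<lambda>k. th k * (\<Sum>i\<in>UNIV. P k i g * expect x0 t m (indicator (cyl ((s - int k, i) # l)))))
    sums expect x0 t m (indicator (cyl ((s, g) # l)))"
proof -
  \<comment> \<open>\<open>m'\<close> sites precede \<open>s\<close>. The horizon is cut to just
    after \<open>s\<close>, the step at \<open>s\<close> is evaluated, and the horizon is restored
    to \<open>m\<close> to match the other side.\<close>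
  define m' where "m' = nat (s - t)"
  have m': "s = t + int m'" "Suc m' \<le> m" using s by (auto simp: m'_def)
  have mem_upd: "(x(n := h)) \<in> cyl l \<longleftrightarrow> x \<in> cyl l" if "n \<ge> s"
    for x :: "int \<Rightarrow> 'g" and n h
    unfolding cyl_def using l that by fastforce
  then have cyl_upd: "indicator (cyl l) (x(n := h)) = (indicator (cyl l) x :: real)" if "n \<ge> s"
    for x :: "int \<Rightarrow> 'g" and n h
    using that by (simp add: indicator_def)
  define \<psi> where "\<psi> x = kernel g (\<lambda>k. x (s - int k)) * indicator (cyl l) x" for x
  have \<psi>_upd: "\<psi> (x(n := h)) = \<psi> x" if "n \<ge> s" for x n h
    unfolding \<psi>_def kernel_update[OF that] cyl_upd[OF that] ..
  have "expect x0 t m (indicator (cyl ((s, g) # l))) = expect x0 t (Suc m') (indicator (cyl ((s, g) # l)))"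
  proof (rule expect_later[OF m'(2)])
    fix x :: "int \<Rightarrow> 'g" and n h assume n: "n \<ge> t + int (Suc m')"
    then have "(x(n := h)) s = x s" using m'(1) by simp
    moreover have "(x(n := h)) \<in> cyl l \<longleftrightarrow> x \<in> cyl l"
      using n m'(1) by (intro mem_upd) simp
    ultimately show "indicator (cyl ((s, g) # l)) (x(n := h)) = (indicator (cyl ((s, g) # l)) x :: real)"
      unfolding cyl_def indicator_def by simp
  qed
  also have "\<dots> = expect x0 t m' \<psi>"
  proof -
    have "kernel h (\<lambda>k. x (s - int k)) * indicator (cyl ((s, g) # l)) (x(s := h))
        = (if h = g then \<psi> x else 0)" for x h
    proof -
      have "indicator (cyl ((s, g) # l)) (x(s := h)) = (if h = g then indicator (cyl l) (x(s := h)) else (0 :: real))"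
        by (simp add: cyl_Cons indicator_def)
      then show ?thesis using cyl_upd[of s x h] by (cases "h = g") (simp_all add: \<psi>_def)
    qed
    then show ?thesis by (simp add: m'(1)[symmetric])
  qed
  also have "\<dots> = expect x0 t m \<psi>"
    using m' \<psi>_upd by (intro expect_later[symmetric]) auto
  finally have eq: "expect x0 t m (indicator (cyl ((s, g) # l))) = expect x0 t m \<psi>" .
  have "(\<lambda>k. th k * P k (x (s - int k)) g * indicator (cyl l) x) sums \<psi> x" for x
    unfolding \<psi>_def by (intro sums_mult2 kernel_sums)
  then have "(\<lambda>k. expect x0 t m (\<lambda>x. th k * P k (x (s - int k)) g * indicator (cyl l) x)) sums expect x0 t m \<psi>"
    by (rule expect_sums)
  moreover have "expect x0 t m (\<lambda>x. th k * P k (x (s - int k)) g * indicator (cyl l) x)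
      = th k * (\<Sum>i\<in>UNIV. P k i g * expect x0 t m (indicator (cyl ((s - int k, i) # l))))" for k
  proof -
    have "P k (x (s - int k)) g * indicator (cyl l) x
        = (\<Sum>i\<in>UNIV. P k i g * indicator (cyl ((s - int k, i) # l)) x)" for x
    proof -
      have "indicator (cyl ((s - int k, i) # l)) x = (if i = x (s - int k) then indicator (cyl l) x else 0 :: real)" for i
        by (auto simp: cyl_def indicator_def)
      then show ?thesis by (simp add: if_distrib[of "\<lambda>z. _ * z"] cong: if_cong)
    qed
    then show ?thesis by (simp only: mult.assoc expect_scale expect_sum[OF finite])
  qed
  ultimately show ?thesis unfolding eq by simp
qed

text \<open>A state outside \<open>V s\<close> has transition probability 0 from every possible
  ancestor, hence kernel probability 0.\<close>

lemma expect_support: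
  assumes V: "invariant_sets V" and x0: "\<And>n. x0 n \<in> V n"
    and \<phi>: "\<And>x. (\<And>n. x n \<in> V n) \<Longrightarrow> \<phi> x = 0"
  shows "expect x0 t m \<phi> = 0"
  using \<phi>
proof (induction m arbitrary: \<phi>)
  case 0
  then show ?case using x0 by simp
next
  case (Suc m)
  define s where "s = t + int m"
  have "(\<Sum>g\<in>UNIV. kernel g (\<lambda>k. x (s - int k)) * \<phi> (x(s := g))) = 0" if x: "\<And>n. x n \<in> V n" for x
  proof (rule sum.neutral, rule ballI)
    fix g
    show "kernel g (\<lambda>k. x (s - int k)) * \<phi> (x(s := g)) = 0"
    proof (cases "\<exists>k\<in>A. P k (x (s - int k)) g > 0")
      case True
      then have "g \<in> V s" using V x unfolding invariant_sets_def by blast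
      then have "\<phi> (x(s := g)) = 0" using x by (intro Suc.prems) simp
      then show ?thesis by simp
    next
      case False
      then have "th k * P k (x (s - int k)) g = 0" for k
        using P_nonneg[of k "x (s - int k)" g] by (cases "k \<in> A") (auto simp: th_def not_less order_antisym)
      then have "(\<lambda>k. th k * P k (x (s - int k)) g) = (\<lambda>_. 0)" by blast
      then have "kernel g (\<lambda>k. x (s - int k)) = 0"
        using kernel_sums[of "\<lambda>k. x (s - int k)" g] by (simp only: sums_unique2[OF _ sums_zero])
      then show ?thesis by simp
    qed
  qed
  then show ?case unfolding expect.simps s_def[symmetric] by (rule Suc.IH)
qed

end

section \<open>From limits of cylinder probabilities to a law\<close>

lemma cyl_graph:
  assumes "finite J"
  shows "cyl (map (\<lambda>j. (j, h j)) (sorted_list_of_set J)) = {x. \<forall>j\<in>J. x j = h j}"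
  using assms by (simp add: cyl_def)

text \<open>This extends convergence from cylinders to all functions of finitely many sites.\<close>

lemma restrict_eq_sum:
  fixes \<Phi> :: "(int \<Rightarrow> 'g::finite) \<Rightarrow> real"
  assumes "finite J"
  shows "\<Phi> (restrict x J)
    = (\<Sum>h\<in>PiE J (\<lambda>_. UNIV). \<Phi> h * indicator (cyl (map (\<lambda>j. (j, h j)) (sorted_list_of_set J))) x)"
proof -
  have "\<Phi> h * indicator (cyl (map (\<lambda>j. (j, h j)) (sorted_list_of_set J))) x
      = (if h = restrict x J then \<Phi> h else 0)" if "h \<in> PiE J (\<lambda>_. UNIV)" for h
  proof -
    have "(\<forall>j\<in>J. x j = h j) \<longleftrightarrow> h = restrict x J"
      using that by (auto simp: fun_eq_iff restrict_def PiE_def extensional_def)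
    then show ?thesis unfolding cyl_graph[OF assms] by (simp add: indicator_def)
  qed
  moreover have "restrict x J \<in> PiE J (\<lambda>_. UNIV)" by auto
  moreover have "finite (PiE J (\<lambda>_. UNIV :: 'g set))" using assms by (intro finite_PiE) auto
  ultimately show ?thesis by (simp add: sum.delta cong: sum.cong)
qed

text \<open>The library has the Daniell-Kolmogorov theorem for Polish spaces, hence the encoding of
  states as reals.\<close>
lemma kolmogorov_finite_states:
  fixes q :: "int set \<Rightarrow> (int \<Rightarrow> 'g::finite) pmf"
  assumes consistent: "\<And>J H. finite H \<Longrightarrow> J \<subseteq> H \<Longrightarrow> map_pmf (\<lambda>h. restrict h J) (q H) = q J"
  shows "\<exists>M. prob_space M \<and> sets M = sets pathspace \<and>
    (\<forall>l. measure M (cyl l) = measure (measure_pmf (q (fst ` set l))) (cyl l))"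
proof -
  \<comment> \<open>States are coded as natural numbers inside the reals; \<open>dec\<close> is a
    measurable left inverse.\<close>
  define enc dec where "enc g = real (to_nat (g :: 'g))" and "dec y = (from_nat (nat \<lfloor>y\<rfloor>) :: 'g)" for g and y :: real
  have dec_enc: "dec (enc g) = g" for g by (simp add: enc_def dec_def)
  have dec_meas: "dec \<in> measurable borel (count_space UNIV)"
    unfolding dec_def by (rule measurable_compose[OF measurable_real_floor]) simp
  define e where "e J h = restrict (\<lambda>j. enc (h j)) J" for J and h :: "int \<Rightarrow> 'g"
  let ?B = "\<lambda>J :: int set. PiM J (\<lambda>_. borel :: real measure)"
  define PJ where "PJ J = distr (measure_pmf (q J)) (?B J) (e J)" for J
  have e_meas: "e J \<in> measurable (measure_pmf p) (?B J)" for J p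
    by (auto simp: e_def space_PiM)
  interpret polish_projective UNIV PJ
  proof (intro polish_projective.intro projective_family.intro, goal_cases)
    case (1 J H)
    then have J: "J \<subseteq> H" "finite H" by simp_all
    have "measure_pmf (q J) = distr (measure_pmf (q H)) (count_space UNIV) (\<lambda>h. restrict h J)"
      unfolding consistent[OF J(2,1), symmetric] by (rule map_pmf_rep_eq)
    then have "PJ J = distr (measure_pmf (q H)) (?B J) (e J \<circ> (\<lambda>h. restrict h J))"
      unfolding PJ_def by (simp add: distr_distr e_def space_PiM)
    also have "e J \<circ> (\<lambda>h. restrict h J) = (\<lambda>f. restrict f J) \<circ> e H"
      using J(1) by (auto simp: e_def fun_eq_iff)
    also have "distr (measure_pmf (q H)) (?B J) \<dots> = distr (PJ H) (?B J) (\<lambda>f. restrict f J)"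
      unfolding PJ_def by (rule distr_distr[symmetric, OF measurable_restrict_subset[OF J(1)] e_meas])
    finally show "PJ J = distr (PJ H) (?B J) (\<lambda>f. restrict f J)" .
  next
    case (2 J)
    show "prob_space (PJ J)"
      unfolding PJ_def by (rule prob_space.prob_space_distr[OF prob_space_measure_pmf e_meas])
  qed
  define M where "M = distr lim pathspace (\<lambda>y n. dec (y n))"
  have meas: "(\<lambda>y n. dec (y n)) \<in> measurable lim pathspace"
    unfolding pathspace_def
  proof (rule measurable_PiM_single')
    show "(\<lambda>y. dec (y n)) \<in> measurable lim (count_space UNIV)" for n
      by (rule measurable_compose[OF _ dec_meas]) (simp add: measurable_cong_sets[OF sets_lim refl])
  qed auto
  have "prob_space M" unfolding M_def by (rule P.prob_space_distr[OF meas])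
  moreover have "sets M = sets pathspace" by (simp add: M_def)
  moreover have "measure M (cyl l) = measure (measure_pmf (q (fst ` set l))) (cyl l)" for l
  proof -
    define J where "J = fst ` set l"
    define X where "X = {y \<in> space (?B J). \<forall>p\<in>set l. dec (y (fst p)) = snd p}"
    have J: "finite J" by (simp add: J_def)
    have X: "X \<in> sets (?B J)"
      unfolding X_def
    proof (rule sets.sets_Collect_finite_All)
      fix p assume "p \<in> set l"
      then have "fst p \<in> J" by (simp add: J_def)
      then have "(\<lambda>y. dec (y (fst p))) \<in> measurable (?B J) (count_space UNIV)"
        by (intro measurable_compose[OF _ dec_meas] measurable_component_singleton)
      from measurable_sets[OF this, of "{snd p}"]
      show "{y \<in> space (?B J). dec (y (fst p)) = snd p} \<in> sets (?B J)"
        by (simp add: vimage_def Int_def conj_commute)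
    qed simp
    have "cyl l \<in> sets (pathspace :: (int \<Rightarrow> 'g) measure)"
      unfolding sets_pathspace by (rule sigma_sets.Basic) simp
    then have "measure M (cyl l) = measure lim ((\<lambda>y n. dec (y n)) -` cyl l \<inter> space lim)"
      unfolding M_def by (rule measure_distr[OF meas])
    also have "(\<lambda>y n. dec (y n)) -` cyl l \<inter> space lim = prod_emb UNIV (\<lambda>_. borel) J X"
      by (auto simp: prod_emb_def space_PiM X_def cyl_def J_def)
    also have "measure lim \<dots> = measure (PJ J) X" using J X by (intro measure_lim_emb) auto
    also have "\<dots> = measure (measure_pmf (q J)) (e J -` X \<inter> space (measure_pmf (q J)))"
      unfolding PJ_def by (rule measure_distr[OF e_meas X])
    also have "e J -` X \<inter> space (measure_pmf (q J)) = cyl l"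
      by (auto simp: X_def e_def space_PiM cyl_def J_def dec_enc)
    finally show ?thesis unfolding J_def .
  qed
  ultimately show ?thesis by blast
qed

context imitation
begin

declare expect.simps [simp del]

lemma existence:
  assumes V: "invariant_sets V"
  shows "\<exists>M. compatible kernel M \<and> (\<forall>n g. g \<notin> V n \<longrightarrow> measure M (cyl [(n, g)]) = 0)"
proof -
  have "\<forall>n. \<exists>i. i \<in> V n" using V unfolding invariant_sets_def by auto
  then obtain x0 where x0: "\<And>n. x0 n \<in> V n" by metis
  \<comment> \<open>Stage \<open>N\<close> resamples the sites from \<open>-N\<close> to
    \<open>N\<close>, so every fixed site is eventually inside the window.\<close>
  define EN where "EN N = expect x0 (- int N) (2 * N + 1)" for N
  have bd: "norm (EN N (indicator (cyl l))) \<le> 1" for N l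
    using expect_indicator_bounds by (simp add: EN_def)
  \<comment> \<open>Finite lists of site-state pairs are countable, so a diagonal argument yields
    one subsequence along which all cylinder probabilities converge.\<close>
  obtain r where r: "strict_mono (r :: nat \<Rightarrow> nat)"
    and "\<And>l. \<exists>y. (\<lambda>N. EN (r N) (indicator (cyl l))) \<longlonglongrightarrow> y"
    using function_convergent_subsequence[of UNIV "\<lambda>N l. EN N (indicator (cyl l))" 1] bd by auto
  then obtain lm where lm: "\<And>l. (\<lambda>N. EN (r N) (indicator (cyl l))) \<longlonglongrightarrow> lm l" by metis
  have lm_nonneg: "lm l \<ge> 0" for l
    using lm by (rule LIMSEQ_le_const) (simp add: EN_def expect_indicator_bounds)
  define gr where "gr J h = map (\<lambda>j. (j, h j)) (sorted_list_of_set J)" for J :: "int set" and h :: "int \<Rightarrow> 'g"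
  let ?E = "\<lambda>J. PiE J (\<lambda>_. UNIV) :: (int \<Rightarrow> 'g) set"
  have fin: "finite (?E J)" if "finite J" for J :: "int set" using that by (intro finite_PiE) auto
  have lim_fun: "(\<lambda>N. EN (r N) (\<lambda>x. \<Phi> (restrict x J))) \<longlonglongrightarrow> (\<Sum>h\<in>?E J. \<Phi> h * lm (gr J h))"
    if J: "finite J" for J \<Phi>
  proof -
    have "EN N (\<lambda>x. \<Phi> (restrict x J)) = (\<Sum>h\<in>?E J. \<Phi> h * EN N (indicator (cyl (gr J h))))" for N
      unfolding EN_def gr_def restrict_eq_sum[OF J] expect_sum[OF fin[OF J]] expect_scale ..
    then show ?thesis by (simp only:) (intro tendsto_sum tendsto_mult tendsto_const lm)
  qed
  have total: "(\<Sum>h\<in>?E J. lm (gr J h)) = 1" if J: "finite J" for J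
    using lim_fun[OF J, of "\<lambda>_. 1"] by (simp add: EN_def expect_one LIMSEQ_const_iff)
  \<comment> \<open>The marginal law on \<open>J\<close>, carried by extensional functions so that
    each full assignment on \<open>J\<close> is a single atom.\<close>
  define q where "q J = embed_pmf (\<lambda>h. if h \<in> ?E J then lm (gr J h) else 0)" for J
  have pmf_q: "pmf (q J) h = (if h \<in> ?E J then lm (gr J h) else 0)" if J: "finite J" for J h
    unfolding q_def
  proof (rule pmf_embed_pmf)
    have "(\<integral>\<^sup>+ h. ennreal (if h \<in> ?E J then lm (gr J h) else 0) \<partial>count_space UNIV)
        = (\<Sum>h\<in>?E J. ennreal (lm (gr J h)))"
      using fin[OF J] by (subst nn_integral_count_space'[of "?E J"]) auto
    also have "\<dots> = ennreal (\<Sum>h\<in>?E J. lm (gr J h))" using lm_nonneg by (intro sum_ennreal)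
    finally show "(\<integral>\<^sup>+ h. ennreal (if h \<in> ?E J then lm (gr J h) else 0) \<partial>count_space UNIV) = 1"
      using total[OF J] by simp
  qed (simp add: lm_nonneg)
  have measure_q: "measure (measure_pmf (q J)) X = (\<Sum>h\<in>?E J. indicator X h * lm (gr J h))"
    if J: "finite J" for J X
  proof -
    have "set_pmf (q J) \<subseteq> ?E J" using pmf_q[OF J] by (auto simp: set_pmf_iff split: if_splits)
    then have "measure (measure_pmf (q J)) X = measure (measure_pmf (q J)) (X \<inter> ?E J)"
      by (metis Int_assoc inf.absorb_iff2 measure_Int_set_pmf)
    also have "\<dots> = (\<Sum>h\<in>X \<inter> ?E J. pmf (q J) h)"
      using fin[OF J] by (intro measure_measure_pmf_finite) auto
    also have "\<dots> = (\<Sum>h\<in>?E J. indicator X h * lm (gr J h))"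
      using fin[OF J] pmf_q[OF J]
      by (intro sum.mono_neutral_cong_left) (auto simp: indicator_def)
    finally show ?thesis .
  qed
  have consistent: "map_pmf (\<lambda>h. restrict h J) (q H) = q J" if H: "finite H" "J \<subseteq> H" for J H
  proof (rule pmf_eqI)
    fix h
    have J: "finite J" using H finite_subset by blast
    have "pmf (map_pmf (\<lambda>h. restrict h J) (q H)) h = measure (measure_pmf (q H)) {h'. restrict h' J = h}"
      by (simp add: pmf_map vimage_def)
    also have "\<dots> = (\<Sum>h'\<in>?E H. of_bool (restrict h' J = h) * lm (gr H h'))"
      unfolding measure_q[OF H(1)] by (simp add: indicator_def)
    finally have 1: "pmf (map_pmf (\<lambda>h. restrict h J) (q H)) h = (\<Sum>h'\<in>?E H. of_bool (restrict h' J = h) * lm (gr H h'))" .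
    have "pmf (q J) h = (\<Sum>h'\<in>?E J. of_bool (h' = h) * lm (gr J h'))"
      unfolding pmf_q[OF J] using fin[OF J] by (simp add: of_bool_def if_distrib[of "\<lambda>z. z * _"] cong: if_cong)
    \<comment> \<open>Restricting through \<open>H\<close> first changes nothing, so the two sums
      are limits of the same expectations.\<close>
    moreover have "(\<lambda>x. of_bool (restrict (restrict x H) J = h) :: real) = (\<lambda>x. of_bool (restrict x J = h))"
      using H(2) by (simp add: Int_absorb1)
    then have "(\<Sum>h'\<in>?E J. of_bool (h' = h) * lm (gr J h')) = (\<Sum>h'\<in>?E H. of_bool (restrict h' J = h) * lm (gr H h'))"
      using lim_fun[OF J, of "\<lambda>h'. of_bool (h' = h)"] lim_fun[OF H(1), of "\<lambda>h'. of_bool (restrict h' J = h)"]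
      by (simp only: LIMSEQ_unique)
    ultimately show "pmf (map_pmf (\<lambda>h. restrict h J) (q H)) h = pmf (q J) h" using 1 by simp
  qed
  obtain M where M: "prob_space M" "sets M = sets pathspace"
    and Mq: "\<And>l. measure M (cyl l) = measure (measure_pmf (q (fst ` set l))) (cyl l)"
    using kolmogorov_finite_states[of q] consistent by blast
  have M_lm: "measure M (cyl l) = lm l" for l
  proof -
    define J where "J = fst ` set l"
    have J: "finite J" by (simp add: J_def)
    have "restrict x J \<in> cyl l \<longleftrightarrow> x \<in> cyl l" for x by (force simp: cyl_def J_def)
    then have "(\<lambda>x. indicator (cyl l) (restrict x J) :: real) = indicator (cyl l)"
      by (auto simp: indicator_def)
    then have "(\<lambda>N. EN (r N) (indicator (cyl l))) \<longlonglongrightarrow> measure M (cyl l)"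
      using lim_fun[OF J, of "indicator (cyl l)"] unfolding Mq J_def[symmetric] measure_q[OF J] by simp
    then show ?thesis by (rule LIMSEQ_unique) (rule lm)
  qed
  interpret imitation_law A \<theta> P M
    using M by (intro imitation_law.intro path_law.intro path_law_axioms.intro imitation_axioms)
  have "compatible kernel M"
  proof (rule compatibleI)
    fix n g l assume l: "\<forall>(m, h)\<in>set (l :: (int \<times> 'g) list). m < n"
    define a where "a k N = th k * (\<Sum>i\<in>UNIV. P k i g * EN (r N) (indicator (cyl ((n - int k, i) # l))))" for k N
    define b where "b k = th k * (\<Sum>i\<in>UNIV. P k i g * lm ((n - int k, i) # l))" for k
    have ab: "(\<lambda>N. a k N) \<longlonglongrightarrow> b k" for k
      unfolding a_def b_def by (intro tendsto_intros lm)
    have bound: "norm (a k N) \<le> th k * real CARD('g)" for k N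
    proof (cases "k \<in> A")
      case True
      have "\<bar>\<Sum>i\<in>UNIV. P k i g * EN (r N) (indicator (cyl ((n - int k, i) # l)))\<bar>
          \<le> (\<Sum>i\<in>(UNIV :: 'g set). 1)"
        using P_nonneg[OF True] P_le_1[OF True] bd
        by (intro order_trans[OF sum_abs] sum_mono) (auto simp: abs_mult intro!: mult_le_one)
      then show ?thesis unfolding a_def using th_nonneg[of k] by (simp add: abs_mult mult_left_mono)
    qed (simp add: a_def th_def)
    have sb: "summable (\<lambda>k. th k * real CARD('g))"
      using th_sums by (intro summable_mult2) (rule sums_summable)
    have "\<forall>\<^sub>F (k, N) in sequentially \<times>\<^sub>F sequentially. norm (a k N) \<le> th k * real CARD('g)"
      using bound by (intro always_eventually) auto
    \<comment> \<open>\<open>A\<close> may be infinite, so the limit has to pass through a series.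
      The majorant works because each of the \<open>CARD('g)\<close> summands is at most 1 in
      absolute value.\<close>
    from tannerys_theorem[OF ab this sb]
    have T: "summable (\<lambda>k. norm (b k))" "(\<lambda>N. \<Sum>k. a k N) \<longlonglongrightarrow> suminf b" by auto
    have "\<forall>\<^sub>F N in sequentially. (\<Sum>k. a k N) = EN (r N) (indicator (cyl ((n, g) # l)))"
      unfolding eventually_sequentially
    proof (intro exI allI impI)
      fix N assume "N \<ge> nat \<bar>n\<bar>"
      \<comment> \<open>This puts \<open>n\<close> inside the resampled window of stage
        \<open>r N\<close>, where the one-step identity is exact.\<close>
      then have "nat \<bar>n\<bar> \<le> r N" using strict_mono_imp_increasing[OF r, of N] by linarith
      then have "(\<lambda>k. a k N) sums EN (r N) (indicator (cyl ((n, g) # l)))"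
        unfolding a_def EN_def using l by (intro expect_cyl_sums) auto
      then show "(\<Sum>k. a k N) = EN (r N) (indicator (cyl ((n, g) # l)))" by (rule sums_unique[symmetric])
    qed
    then have "(\<lambda>N. EN (r N) (indicator (cyl ((n, g) # l)))) \<longlonglongrightarrow> suminf b"
      using T(2) by (simp cong: tendsto_cong)
    then have "suminf b = lm ((n, g) # l)" by (rule LIMSEQ_unique) (rule lm)
    moreover have "b sums suminf b" using summable_norm_cancel[OF T(1)] by (rule summable_sums)
    ultimately show "(\<lambda>k. th k * (\<Sum>i\<in>UNIV. P k i g * measure M (cyl ((n - int k, i) # l))))
        sums measure M (cyl ((n, g) # l))"
      unfolding M_lm b_def by simp
  qed
  moreover have "measure M (cyl [(n, g)]) = 0" if g: "g \<notin> V n" for n g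
  proof -
    have "EN N (indicator (cyl [(n, g)])) = 0" for N
      unfolding EN_def using g by (intro expect_support[OF V x0]) (auto simp: cyl_def indicator_def)
    then have "lm [(n, g)] = 0" using lm[of "[(n, g)]"] by (simp add: LIMSEQ_const_iff)
    then show ?thesis using M_lm by simp
  qed
  ultimately show ?thesis by blast
qed

section \<open>Characterization of uniqueness\<close>

text \<open>If the two laws coincided, every state at site 0 would lie outside \<open>V 0\<close> or
  outside \<open>V' 0\<close> and have probability 0.\<close>

lemma disjoint_invariant_sets_two_laws:
  assumes "invariant_sets V" "invariant_sets V'" "V 0 \<inter> V' 0 = {}"
  shows "\<exists>M N. compatible kernel M \<and> compatible kernel N \<and> M \<noteq> N"
proof -
  obtain M where M: "compatible kernel M" "\<And>n g. g \<notin> V n \<Longrightarrow> measure M (cyl [(n, g)]) = 0"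
    using existence[OF assms(1)] by blast
  obtain N where N: "compatible kernel N" "\<And>n g. g \<notin> V' n \<Longrightarrow> measure N (cyl [(n, g)]) = 0"
    using existence[OF assms(2)] by blast
  interpret imitation_law A \<theta> P M using M(1) by (rule compatible_imitation_law)
  have "M \<noteq> N"
  proof
    assume "M = N"
    then have zero: "measure M (cyl [(0, g)]) = 0" for g using M(2) N(2) assms(3) by blast
    have "(UNIV :: (int \<Rightarrow> 'g) set) = (\<Union>g\<in>UNIV. cyl [(0, g)])" by (auto simp: cyl_def)
    then have "measure M (space M) \<le> (\<Sum>g\<in>UNIV. measure M (cyl [(0, g)]))"
      unfolding space_M using finite_measure_subadditive_finite[of UNIV "\<lambda>g. cyl [(0, g)]"] cyl_sets
      by (simp add: image_subset_iff)
    then show False using zero prob_space by simp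
  qed
  then show ?thesis using M N by blast
qed

lemma unique_law_iff:
  "card (compatible_laws kernel) = 1 \<longleftrightarrow>
    essentially_irreducible A P \<and> (\<forall>R. R \<in> classes A P \<and> closed_class A P R \<longrightarrow> aperiodic_class A P R)"
proof
  assume "card (compatible_laws kernel) = 1"
  then obtain M where "compatible_laws kernel = {M}" by (rule card_1_singletonE)
  then have no_two: "\<not> (\<exists>M N. compatible kernel M \<and> compatible kernel N \<and> M \<noteq> N)"
    unfolding compatible_laws_def by (metis mem_Collect_eq singletonD)
  have "C = C'"
    if C: "C \<in> classes A P" "closed_class A P C" and C': "C' \<in> classes A P" "closed_class A P C'" for C C'
  proof -
    \<comment> \<open>Disjoint closed classes would be disjoint invariant families and produce two
      laws, so the classes share a state, which determines both.\<close>
    obtain i where i: "i \<in> C" "i \<in> C'"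
      using disjoint_invariant_sets_two_laws[OF invariant_sets_closed_class[OF C] invariant_sets_closed_class[OF C']]
        no_two by blast
    have "C = {j. reach i j \<and> reach j i}" "C' = {j. reach i j \<and> reach j i}"
      using C C' i class_reach unfolding closed_class_iff by blast+
    then show ?thesis by simp
  qed
  then have "essentially_irreducible A P"
    unfolding essentially_irreducible_def using closed_class_reachable by metis
  moreover have "aperiodic_class A P R" if R: "R \<in> classes A P" "closed_class A P R" for R
    unfolding aperiodic_class_def return_depths_def[symmetric]
    using invariant_sets_periodic[OF R] disjoint_invariant_sets_two_laws no_two by blast
  ultimately show "essentially_irreducible A P \<and>
      (\<forall>R. R \<in> classes A P \<and> closed_class A P R \<longrightarrow> aperiodic_class A P R)" by blast
next
  assume *: "essentially_irreducible A P \<and>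
    (\<forall>R. R \<in> classes A P \<and> closed_class A P R \<longrightarrow> aperiodic_class A P R)"
  then obtain R where R: "R \<in> classes A P" "closed_class A P R"
    unfolding essentially_irreducible_def by blast
  then obtain j where j: "j \<in> R" using classes_iff reach_refl by blast
  have ap: "Gcd (return_depths j) = Gcd A"
    using * R j unfolding aperiodic_class_def return_depths_def by blast
  \<comment> \<open>The full state space at every site is an invariant family, so
    \<open>existence\<close> yields a compatible law in every case.\<close>
  have "invariant_sets (\<lambda>_. UNIV)" unfolding invariant_sets_def by simp
  then obtain M where "compatible kernel M" using existence by blast
  then have "compatible_laws kernel = {M}"
    unfolding compatible_laws_def using compatible_unique[OF R j _ ap] * by blast
  then show "card (compatible_laws kernel) = 1" by simp
qed

end

theorem mainTheorem10:
  fixes A :: "nat set" and \<theta> :: "nat \<Rightarrow> real"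
    and P :: "nat \<Rightarrow> 'g::finite \<Rightarrow> 'g \<Rightarrow> real"
  assumes A_pos: "A \<subseteq> {1..}"
    and theta_pos: "\<And>k. k \<in> A \<Longrightarrow> \<theta> k > 0"
    and theta_prob: "(\<theta> has_sum 1) A"
    and P_stoch: "\<And>k. k \<in> A \<Longrightarrow> stochastic (P k)"
  shows "card (compatible_laws (imitation_kernel A \<theta> P)) = 1 \<longleftrightarrow>
    (essentially_irreducible A P \<and>
     (\<forall>R. R \<in> classes A P \<and> closed_class A P R \<longrightarrow> aperiodic_class A P R))"
proof -
  interpret imitation A \<theta> P using assms by unfold_locales
  show ?thesis using unique_law_iff unfolding kernel_def .
qed

end
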